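(* There exist absolute constants $C\geq1$ and $C_1\geq1$ such that the following holds. Let $\delta\in2^{-\mathbb{N}}$ with $\delta\leq\tfrac12$, let $\theta\in(0,1]$, and let $P\times\mathcal{L}$ be a $(\delta,\theta)$-clique with $P\subset[0,1)^2$ and $\mathcal{L}\subset\mathcal{A}(2)$ nonempty. Then there exist $\Delta\in[\delta,2]$ and a rectangle $R\subset\mathbb{R}^2$ of dimensions $C\delta\times C\Delta$ such that $$|P\cap R|_\delta\geq C_1^{-1}\theta^2|P|_\delta\quad\text{and}\quad|\{\ell\in\mathcal{L}:R\subset[\ell]_{C\delta}\}|_\delta\geq C_1^{-1}(\log_2(1/\delta))^{-C_1}\theta^4|\mathcal{L}|_\delta.$$ In particular, for all $s,t\in(0,1]$ and $K_P,K_{\mathcal{L}}\geq1$ there is a constant $C_2=C_2(K_P,K_{\mathcal{L}})\geq 1$ such that if, in addition, $P$ is a Katz-Tao $(\delta,s,K_P)$-set and $\mathcal{L}$ is a Katz-Tao $(\delta,t,K_{\mathcal{L}})$-set of lines, then $$|P|_\delta^t\,|\mathcal{L}|_\delta^s\leq C_2(\log_2(1/\delta))^{C_2}\,\theta^{-6}\,\delta^{-st}.$$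
   Context: $\mathcal{A}(2)$ is the set of all affine lines in $\mathbb{R}^2$, with the metric $d_{\mathcal{A}(2)}(\ell_1,\ell_2)=\|\pi_{L_1}-\pi_{L_2}\|+|a_1-a_2|$, where $\ell_j=L_j+a_j$, $L_j$ is the $1$-dimensional subspace parallel to $\ell_j$, $a_j\in L_j^\perp$, $\pi_L$ is the orthogonal projection onto $L$, and $\|\cdot\|$ is the operator norm. For $P\subset\mathbb{R}^2$ and $\mathcal{L}\subset\mathcal{A}(2)$, the set of incidences is $\mathcal{I}(P,\mathcal{L})=\{(p,\ell)\in P\times\mathcal{L}:p\in\ell\}$. For a line $\ell$ and $r>0$, $[\ell]_r$ is the $r$-neighbourhood of $\ell$ in $\mathbb{R}^2$. Rectangles may be arbitrarily oriented. $|\cdot|_\delta$ denotes the $\delta$-covering number (the least number of balls of radius $\delta$ needed to cover): for subsets of $\mathbb{R}^2$ in the Euclidean metric, for subsets of $\mathcal{A}(2)$ in $d_{\mathcal{A}(2)}$, and for subsets of $\mathbb{R}^2\times\mathcal{A}(2)$ in the metric $d((x,\ell),(x',\ell'))=\max\{|x-x'|,d_{\mathcal{A}(2)}(\ell,\ell')\}$. $(\delta,\theta)$-clique: a pair $P\times\mathcal{L}\subset\mathbb{R}^2\times\mathcal{A}(2)$ with $|\mathcal{I}(P,\mathcal{L})|_\delta\geq\theta|P|_\delta|\mathcal{L}|_\delta$. Katz-Tao $(\delta,s,K)$-set of points: a bounded set $P\subset\mathbb{R}^2$ with $|P\cap B(x,r)|_\delta\leq K(r/\delta)^s$ for all $x\in\mathbb{R}^2$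 and $\delta\leq r\leq1$. Katz-Tao $(\delta,t,K)$-set of lines: a family $\mathcal{L}\subset\mathcal{A}(2)$ with $|\mathcal{L}\cap B_{\mathcal{A}(2)}(\ell,r)|_\delta\leq K(r/\delta)^t$ for all $\ell\in\mathcal{A}(2)$ and $\delta\leq r\leq1$, where $B_{\mathcal{A}(2)}(\ell,r)$ is a ball in $d_{\mathcal{A}(2)}$. *)

theory Defs
  imports "HOL-Analysis.Analysis"
begin

section \<open>Affine lines in the plane and their metric\<close>

definition affine_lines :: "(real^2) set set" where
  "affine_lines = {l. affine l \<and> aff_dim l = 1}"

definition direction :: "(real^2) set \<Rightarrow> (real^2) set" where
  "direction l = span {x - y | x y. x \<in> l \<and> y \<in> l}"

text \<open>The vector \<open>a\<close> in the decomposition \<open>l = L + a\<close> with \<open>L = direction l\<close> and \<open>a \<in> L\<^sup>\<bottom>\<close>;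
  see \<open>affine_line_decomp\<close> and \<open>line_offset_eqI\<close> below.\<close>

definition line_offset :: "(real^2) set \<Rightarrow> real^2" where
  "line_offset l = (THE a. a \<in> l \<inter> (direction l)\<^sup>\<bottom>)"

definition orth_proj :: "(real^2) set \<Rightarrow> real^2 \<Rightarrow> real^2" where
  "orth_proj L x = (THE y. y \<in> L \<and> x - y \<in> L\<^sup>\<bottom>)"

definition line_dist :: "(real^2) set \<Rightarrow> (real^2) set \<Rightarrow> real" where
  "line_dist l1 l2 =
     onorm (\<lambda>x. orth_proj (direction l1) x - orth_proj (direction l2) x)
     + norm (line_offset l1 - line_offset l2)"

lemma orth_proj_eqI:
  assumes "subspace L" "y \<in> L" "x - y \<in> L\<^sup>\<bottom>"
  shows "orth_proj L x = y"
  unfolding orth_proj_def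
proof (rule the_equality)
  show "y \<in> L \<and> x - y \<in> L\<^sup>\<bottom>" using assms by simp
next
  fix z assume z: "z \<in> L \<and> x - z \<in> L\<^sup>\<bottom>"
  have "(x - y) - (x - z) \<in> L\<^sup>\<bottom>"
    using subspace_diff[OF subspace_orthogonal_comp] assms z by blast
  hence 1: "z - y \<in> L\<^sup>\<bottom>" by simp
  have "z - y \<in> L" using assms z by (intro subspace_diff) auto
  with 1 have "orthogonal (z - y) (z - y)" by (auto simp: orthogonal_comp_def)
  thus "z = y" by (simp add: orthogonal_self)
qed

lemma orth_proj_works:
  assumes "subspace L"
  shows "orth_proj L x \<in> L" "x - orth_proj L x \<in> L\<^sup>\<bottom>"
proof -
  obtain y z where "y \<in> span L" "\<And>w. w \<in> span L \<Longrightarrow> orthogonal z w" "x = y + z"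
    using orthogonal_subspace_decomp_exists by blast
  hence y: "y \<in> L" "x - y \<in> L\<^sup>\<bottom>"
    using assms by (auto simp: orthogonal_comp_def orthogonal_commute span_eq_iff[THEN iffD2])
  from orth_proj_eqI[OF assms y] y show "orth_proj L x \<in> L" "x - orth_proj L x \<in> L\<^sup>\<bottom>" by auto
qed

lemma linear_orth_proj:
  assumes L: "subspace L"
  shows "linear (orth_proj L)"
proof (rule linearI)
  fix x y :: "real^2" and r :: real
  show "orth_proj L (x + y) = orth_proj L x + orth_proj L y"
  proof (rule orth_proj_eqI[OF L])
    show "orth_proj L x + orth_proj L y \<in> L" using L orth_proj_works[OF L] by (simp add: subspace_add)
    have "(x - orth_proj L x) + (y - orth_proj L y) \<in> L\<^sup>\<bottom>"
      using orth_proj_works[OF L] by (intro subspace_add subspace_orthogonal_comp)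
    thus "x + y - (orth_proj L x + orth_proj L y) \<in> L\<^sup>\<bottom>" by (simp add: algebra_simps)
  qed
  show "orth_proj L (r *\<^sub>R x) = r *\<^sub>R orth_proj L x"
  proof (rule orth_proj_eqI[OF L])
    show "r *\<^sub>R orth_proj L x \<in> L" using L orth_proj_works[OF L] by (simp add: subspace_scale)
    have "r *\<^sub>R (x - orth_proj L x) \<in> L\<^sup>\<bottom>"
      using orth_proj_works[OF L] by (intro subspace_scale subspace_orthogonal_comp)
    thus "r *\<^sub>R x - r *\<^sub>R orth_proj L x \<in> L\<^sup>\<bottom>" by (simp add: algebra_simps)
  qed
qed

lemma range_orth_proj:
  assumes "subspace L"
  shows "range (orth_proj L) = L"
proof -
  have "orth_proj L x = x" if "x \<in> L" for x
    using that assms subspace_orthogonal_comp[of L] by (intro orth_proj_eqI) (auto simp: subspace_0)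
  thus ?thesis using orth_proj_works(1)[OF assms] by (auto simp: image_iff) metis
qed

lemma subspace_direction: "subspace (direction l)"
  by (simp add: direction_def)

lemma bounded_linear_proj_diff:
  "bounded_linear (\<lambda>x. orth_proj (direction l1) x - orth_proj (direction l2) x)"
  using linear_orth_proj[OF subspace_direction]
  by (intro bounded_linear_sub) (auto simp: linear_conv_bounded_linear)

lemma affine_line_translate:
  assumes "affine l" "a \<in> l"
  shows "l = (\<lambda>x. a + x) ` direction l"
proof -
  define L where "L = {y - a | y. y \<in> l}"
  have L: "subspace L"
    using affine_diffs_subspace_subtract[OF assms] by (simp add: L_def setcompr_eq_image)
  have "{x - y | x y. x \<in> l \<and> y \<in> l} = L"
  proof safe
    fix x y assume "x \<in> l" "y \<in> l"
    hence "x - a \<in> L" "y - a \<in> L" by (auto simp: L_def)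
    hence "(x - a) - (y - a) \<in> L" by (rule subspace_diff[OF L])
    thus "x - y \<in> L" by simp
  next
    fix x assume "x \<in> L"
    thus "\<exists>u v. x = u - v \<and> u \<in> l \<and> v \<in> l" using assms by (auto simp: L_def)
  qed
  hence "direction l = L" using L by (simp add: direction_def span_eq_iff[THEN iffD2])
  moreover have "l = (\<lambda>x. a + x) ` L"
    by (force simp: L_def image_iff)
  ultimately show ?thesis by simp
qed

lemma line_offset_eqI:
  assumes "affine l" "a \<in> l" "a \<in> (direction l)\<^sup>\<bottom>"
  shows "line_offset l = a"
  unfolding line_offset_def
proof (rule the_equality)
  show "a \<in> l \<inter> (direction l)\<^sup>\<bottom>" using assms by simp
next
  fix b assume b: "b \<in> l \<inter> (direction l)\<^sup>\<bottom>"
  hence "b - a \<in> direction l" unfolding direction_def using assms by (intro span_base) auto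
  moreover have "b - a \<in> (direction l)\<^sup>\<bottom>"
    using b assms by (intro subspace_diff subspace_orthogonal_comp) auto
  ultimately have "orthogonal (b - a) (b - a)" by (auto simp: orthogonal_comp_def)
  thus "b = a" by (simp add: orthogonal_self)
qed

lemma affine_line_decomp:
  assumes "l \<in> affine_lines"
  shows "subspace (direction l)" "dim (direction l) = 1"
    "line_offset l \<in> (direction l)\<^sup>\<bottom>" "l = (\<lambda>x. line_offset l + x) ` direction l"
proof -
  have l: "affine l" "aff_dim l = 1" using assms by (auto simp: affine_lines_def)
  hence "l \<noteq> {}" by auto
  then obtain b where b: "b \<in> l" by blast
  note tr = affine_line_translate[OF l(1)]
  show s: "subspace (direction l)" by (rule subspace_direction)
  have "int (dim (direction l)) = aff_dim (direction l)" using s by (simp add: aff_dim_subspace)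
  also have "\<dots> = aff_dim ((\<lambda>x. b + x) ` direction l)" by (simp add: aff_dim_translation_eq)
  also have "\<dots> = 1" using tr[OF b] l by simp
  finally show "dim (direction l) = 1" by simp
  define a where "a = b - orth_proj (direction l) b"
  have aperp: "a \<in> (direction l)\<^sup>\<bottom>" unfolding a_def by (rule orth_proj_works[OF s])
  have "- orth_proj (direction l) b \<in> direction l"
    using orth_proj_works[OF s] s by (simp add: subspace_neg)
  hence "a \<in> l" unfolding a_def by (subst tr[OF b]) (auto simp: image_iff)
  hence a: "line_offset l = a" "a \<in> l" using line_offset_eqI l aperp by auto
  show "line_offset l \<in> (direction l)\<^sup>\<bottom>" using a aperp by simp
  show "l = (\<lambda>x. line_offset l + x) ` direction l" using tr a by simp
qed

lemma Metric_space_lines: "Metric_space affine_lines line_dist"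
proof
  fix l1 l2 :: "(real^2) set"
  show "0 \<le> line_dist l1 l2"
    unfolding line_dist_def using onorm_pos_le[OF bounded_linear_proj_diff] by simp
  have "onorm (\<lambda>x. orth_proj (direction l2) x - orth_proj (direction l1) x)
      = onorm (\<lambda>x. - (orth_proj (direction l1) x - orth_proj (direction l2) x))"
    by simp
  also have "\<dots> = onorm (\<lambda>x. orth_proj (direction l1) x - orth_proj (direction l2) x)"
    by (rule onorm_neg)
  finally show "line_dist l1 l2 = line_dist l2 l1"
    unfolding line_dist_def by (simp add: norm_minus_commute)
next
  fix l1 l2 assume l: "l1 \<in> affine_lines" "l2 \<in> affine_lines"
  show "line_dist l1 l2 = 0 \<longleftrightarrow> l1 = l2"
  proof
    assume "line_dist l1 l2 = 0"
    hence o: "onorm (\<lambda>x. orth_proj (direction l1) x - orth_proj (direction l2) x) = 0"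
      and "norm (line_offset l1 - line_offset l2) = 0"
      unfolding line_dist_def
      by (simp_all only: add_nonneg_eq_0_iff[OF onorm_pos_le[OF bounded_linear_proj_diff] norm_ge_zero])
    hence a: "line_offset l1 = line_offset l2" by simp
    have "orth_proj (direction l1) = orth_proj (direction l2)"
      using o by (simp add: onorm_eq_0[OF bounded_linear_proj_diff] fun_eq_iff)
    hence "direction l1 = direction l2"
      using range_orth_proj[OF subspace_direction] by metis
    thus "l1 = l2" using affine_line_decomp(4) l a by metis
  next
    assume "l1 = l2" thus "line_dist l1 l2 = 0" by (simp add: line_dist_def onorm_zero)
  qed
next
  fix l1 l2 l3 assume "l1 \<in> affine_lines" "l2 \<in> affine_lines" "l3 \<in> affine_lines"
  have "onorm (\<lambda>x. orth_proj (direction l1) x - orth_proj (direction l3) x)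
     \<le> onorm (\<lambda>x. orth_proj (direction l1) x - orth_proj (direction l2) x)
      + onorm (\<lambda>x. orth_proj (direction l2) x - orth_proj (direction l3) x)"
    using onorm_triangle[OF bounded_linear_proj_diff[of l1 l2] bounded_linear_proj_diff[of l2 l3]]
    by simp
  moreover have "norm (line_offset l1 - line_offset l3)
     \<le> norm (line_offset l1 - line_offset l2) + norm (line_offset l2 - line_offset l3)"
    by (rule norm_diff_triangle_le) auto
  ultimately show "line_dist l1 l3 \<le> line_dist l1 l2 + line_dist l2 l3"
    unfolding line_dist_def by linarith
qed

interpretation Lines: Metric_space affine_lines line_dist
  by (rule Metric_space_lines)

definition incidence_dist :: "(real^2) \<times> (real^2) set \<Rightarrow> (real^2) \<times> (real^2) set \<Rightarrow> real" where
  "incidence_dist u v = max (dist (fst u) (fst v)) (line_dist (snd u) (snd v))"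

lemma Metric_space_incidence: "Metric_space (UNIV \<times> affine_lines) incidence_dist"
proof
  fix x y :: "(real^2) \<times> (real^2) set"
  show "0 \<le> incidence_dist x y" by (simp add: incidence_dist_def le_max_iff_disj)
  show "incidence_dist x y = incidence_dist y x"
    by (simp add: incidence_dist_def dist_commute Lines.commute)
next
  fix x y :: "(real^2) \<times> (real^2) set"
  assume xy: "x \<in> UNIV \<times> affine_lines" "y \<in> UNIV \<times> affine_lines"
  have "incidence_dist x y = 0 \<longleftrightarrow> dist (fst x) (fst y) = 0 \<and> line_dist (snd x) (snd y) = 0"
    unfolding incidence_dist_def
    using zero_le_dist[of "fst x" "fst y"] Lines.nonneg[of "snd x" "snd y"] by linarith
  thus "incidence_dist x y = 0 \<longleftrightarrow> x = y" using xy by (auto simp: prod_eq_iff)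
next
  fix x y z :: "(real^2) \<times> (real^2) set"
  assume "x \<in> UNIV \<times> affine_lines" "y \<in> UNIV \<times> affine_lines" "z \<in> UNIV \<times> affine_lines"
  hence "line_dist (snd x) (snd z) \<le> line_dist (snd x) (snd y) + line_dist (snd y) (snd z)"
    by (intro Lines.triangle) auto
  thus "incidence_dist x z \<le> incidence_dist x y + incidence_dist y z"
    unfolding incidence_dist_def using dist_triangle[of "fst x" "fst z" "fst y"] by linarith
qed

section \<open>Covering numbers\<close>

text \<open>The values lie in \<^typ>\<open>ennreal\<close>: the covering number is \<open>\<infinity>\<close> if no finite cover exists,
  which can happen for sets of lines. Balls are open.\<close>

definition covering_number :: "'a set \<Rightarrow> ('a \<Rightarrow> 'a \<Rightarrow> real) \<Rightarrow> real \<Rightarrow> 'a set \<Rightarrow> ennreal" where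
  "covering_number M d r S =
     (INF C \<in> {C. finite C \<and> C \<subseteq> M \<and> S \<subseteq> (\<Union>c\<in>C. Metric_space.mball M d c r)}. of_nat (card C))"

abbreviation point_cov :: "real \<Rightarrow> (real^2) set \<Rightarrow> ennreal" where
  "point_cov \<equiv> covering_number UNIV dist"

abbreviation line_cov :: "real \<Rightarrow> (real^2) set set \<Rightarrow> ennreal" where
  "line_cov \<equiv> covering_number affine_lines line_dist"

abbreviation incidence_cov :: "real \<Rightarrow> ((real^2) \<times> (real^2) set) set \<Rightarrow> ennreal" where
  "incidence_cov \<equiv> covering_number (UNIV \<times> affine_lines) incidence_dist"

text \<open>Real powers with positive exponent, extended by \<open>\<infinity>\<^sup>a = \<infinity>\<close>.\<close>

definition ennreal_powr :: "ennreal \<Rightarrow> real \<Rightarrow> ennreal" where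
  "ennreal_powr x a = (if x = \<infinity> then \<infinity> else ennreal (enn2real x powr a))"

section \<open>Cliques, Katz--Tao sets and rectangles\<close>

definition incidences :: "(real^2) set \<Rightarrow> (real^2) set set \<Rightarrow> ((real^2) \<times> (real^2) set) set" where
  "incidences P \<L> = {(p, l). p \<in> P \<and> l \<in> \<L> \<and> p \<in> l}"

definition clique :: "real \<Rightarrow> real \<Rightarrow> (real^2) set \<Rightarrow> (real^2) set set \<Rightarrow> bool" where
  "clique \<delta> \<theta> P \<L> \<longleftrightarrow> \<L> \<subseteq> affine_lines \<and>
     incidence_cov \<delta> (incidences P \<L>) \<ge> ennreal \<theta> * point_cov \<delta> P * line_cov \<delta> \<L>"

definition katz_tao_points :: "real \<Rightarrow> real \<Rightarrow> real \<Rightarrow> (real^2) set \<Rightarrow> bool" where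
  "katz_tao_points \<delta> s K P \<longleftrightarrow> bounded P \<and>
     (\<forall>x r. \<delta> \<le> r \<and> r \<le> 1 \<longrightarrow> point_cov \<delta> (P \<inter> ball x r) \<le> ennreal (K * (r / \<delta>) powr s))"

definition katz_tao_lines :: "real \<Rightarrow> real \<Rightarrow> real \<Rightarrow> (real^2) set set \<Rightarrow> bool" where
  "katz_tao_lines \<delta> t K \<L> \<longleftrightarrow> \<L> \<subseteq> affine_lines \<and>
     (\<forall>l\<in>affine_lines. \<forall>r. \<delta> \<le> r \<and> r \<le> 1 \<longrightarrow>
        line_cov \<delta> (\<L> \<inter> Lines.mball l r) \<le> ennreal (K * (r / \<delta>) powr t))"

definition nbhd :: "(real^2) set \<Rightarrow> real \<Rightarrow> (real^2) set" where
  "nbhd l r = (\<Union>x\<in>l. ball x r)"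

definition is_rectangle :: "real \<Rightarrow> real \<Rightarrow> (real^2) set \<Rightarrow> bool" where
  "is_rectangle a b R \<longleftrightarrow> (\<exists>p e f. norm e = 1 \<and> norm f = 1 \<and> e \<bullet> f = 0 \<and>
     R = {p + u *\<^sub>R e + v *\<^sub>R f | u v. 0 \<le> u \<and> u \<le> a \<and> 0 \<le> v \<and> v \<le> b})"

end

theory Submission
  imports Defs
begin

text \<open>
  Let \<open>X\<close> and \<open>Y\<close> be maximal \<open>\<delta>\<close>-separated subsets of \<open>P\<close> and \<open>\<L>\<close>, so that \<open>\<gtrsim> \<theta> |X| |Y|\<close> pairs
  \<open>(x, l) \<in> X \<times> Y\<close> satisfy \<open>x \<in> [l]\<^bsub>3\<delta>\<^esub>\<close>. Hence \<open>\<gtrsim> \<theta> |Y|\<close> lines are heavy: the set \<open>X\<^sub>l\<close> of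
  net points near \<open>l\<close> has \<open>\<gtrsim> \<theta> |X|\<close> elements. For each heavy \<open>l\<close> there is a dyadic multiple \<open>2\<^sup>k \<delta>\<close>
  of \<open>\<delta>\<close> and a ball of that radius which contains half of \<open>X\<^sub>l\<close> and in which
  \<open>\<gtrsim> |X\<^sub>l|\<^sup>2 / log(1/\<delta>)\<close> pairs are separated by \<open>\<gtrsim> 2\<^sup>k \<delta>\<close>. By the pigeonhole principle some triple
  \<open>(x, x', k)\<close> occurs for \<open>\<gtrsim> \<theta>\<^sup>3 |Y| / (log(1/\<delta>))\<^sup>2\<close> lines. All of these contain in their
  \<open>O(\<delta>)\<close>-neighbourhoods the rectangle of length about \<open>2\<^sup>k \<delta>\<close> centred at \<open>x\<close> and pointing to \<open>x'\<close>,
  and the rectangle contains half of \<open>X\<^sub>l\<close> for each of them.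

  For the Katz--Tao bound, the points in the rectangle lie in a ball of radius \<open>O(\<Delta>)\<close>, and the lines
  through it lie in a ball of radius \<open>O(\<delta> / \<Delta>)\<close> of the space of lines; the powers of \<open>\<Delta>\<close> cancel.
\<close>

section \<open>Covering numbers in doubling spaces\<close>

text \<open>The inequality is weak because balls are open: a point outside every open
  \<open>r\<close>-ball around an \<open>r\<close>-separated set can be added to it.\<close>

definition separated :: "('a \<Rightarrow> 'a \<Rightarrow> real) \<Rightarrow> real \<Rightarrow> 'a set \<Rightarrow> bool" where
  "separated d r X \<longleftrightarrow> (\<forall>x\<in>X. \<forall>y\<in>X. x \<noteq> y \<longrightarrow> r \<le> d x y)"

lemma separated_subset: "separated d r X \<Longrightarrow> Y \<subseteq> X \<Longrightarrow> separated d r Y"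
  unfolding separated_def by blast

section \<open>Elementary properties of covering numbers\<close>

lemma covering_number_le:
  assumes "finite C" "C \<subseteq> M" "S \<subseteq> (\<Union>c\<in>C. Metric_space.mball M d c r)"
  shows "covering_number M d r S \<le> of_nat (card C)"
  unfolding covering_number_def using assms by (intro INF_lower) auto

text \<open>Cardinalities are natural numbers, so the infimum over a nonempty family of finite
  covers is a minimum. Inequalities between finite covering numbers can then be moved from
  \<open>ennreal\<close> to the natural numbers.\<close>

lemma covering_number_attained:
  assumes "covering_number M d r S < \<infinity>"
  obtains C where "finite C" "C \<subseteq> M" "S \<subseteq> (\<Union>c\<in>C. Metric_space.mball M d c r)"
    "covering_number M d r S = of_nat (card C)"
proof -
  define \<C> where "\<C> = {C. finite C \<and> C \<subseteq> M \<and> S \<subseteq> (\<Union>c\<in>C. Metric_space.mball M d c r)}"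
  have eq: "covering_number M d r S = (INF C\<in>\<C>. of_nat (card C))"
    by (simp add: covering_number_def \<C>_def)
  have "\<C> \<noteq> {}"
    using assms unfolding eq by (auto simp: top_ennreal_def)
  then obtain C where C: "C \<in> \<C>" "\<And>C'. C' \<in> \<C> \<Longrightarrow> card C \<le> card C'"
    using ex_has_least_nat[of "\<lambda>C. C \<in> \<C>" _ card] by blast
  have "covering_number M d r S = of_nat (card C)"
    unfolding eq using C by (intro antisym INF_lower INF_greatest) auto
  then show thesis using C(1) that by (auto simp: \<C>_def)
qed

lemma covering_number_empty: "covering_number M d r {} = 0"
  using covering_number_le[of "{}" M "{}"] by simp

lemma covering_number_ge_1:
  assumes "S \<noteq> {}"
  shows "1 \<le> covering_number M d r S"
  unfolding covering_number_def
proof (rule INF_greatest)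
  fix C assume "C \<in> {C. finite C \<and> C \<subseteq> M \<and> S \<subseteq> (\<Union>c\<in>C. Metric_space.mball M d c r)}"
  with assms have "finite C" "C \<noteq> {}" by auto
  then have "1 \<le> card C" by (simp add: Suc_le_eq card_gt_0_iff)
  then show "(1::ennreal) \<le> of_nat (card C)" by (metis of_nat_1 of_nat_le_iff)
qed

lemma covering_number_mono:
  assumes "S \<subseteq> T"
  shows "covering_number M d r S \<le> covering_number M d r T"
  unfolding covering_number_def using assms by (intro INF_superset_mono) auto

lemma covering_number_Un:
  "covering_number M d r (S \<union> T) \<le> covering_number M d r S + covering_number M d r T"
proof (cases "covering_number M d r S < \<infinity> \<and> covering_number M d r T < \<infinity>")
  case True
  obtain C where C: "finite C" "C \<subseteq> M" "S \<subseteq> (\<Union>c\<in>C. Metric_space.mball M d c r)"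
    "covering_number M d r S = of_nat (card C)"
    using True by (elim conjE covering_number_attained)
  obtain D where D: "finite D" "D \<subseteq> M" "T \<subseteq> (\<Union>c\<in>D. Metric_space.mball M d c r)"
    "covering_number M d r T = of_nat (card D)"
    using True by (elim conjE covering_number_attained)
  have "covering_number M d r (S \<union> T) \<le> of_nat (card (C \<union> D))"
    using C D by (intro covering_number_le) auto
  also have "\<dots> \<le> of_nat (card C + card D)"
    using card_Un_le[of C D] by (simp only: of_nat_le_iff)
  finally show ?thesis by (simp add: C D)
next
  case False
  then have "covering_number M d r S + covering_number M d r T = \<infinity>"
    using top.not_eq_extremum by fastforce
  then show ?thesis by (metis infinity_ennreal_def top_greatest)
qed

lemma covering_number_UN_le:
  assumes "finite I" "\<And>i. i \<in> I \<Longrightarrow> covering_number M d r (F i) \<le> k"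
  shows "covering_number M d r (\<Union>i\<in>I. F i) \<le> of_nat (card I) * k"
  using assms
proof (induction I rule: finite_induct)
  case empty
  then show ?case by (simp add: covering_number_empty)
next
  case (insert i I)
  have "covering_number M d r (\<Union>i\<in>insert i I. F i)
      \<le> covering_number M d r (F i) + covering_number M d r (\<Union>i\<in>I. F i)"
    using covering_number_Un[of M d r "F i" "\<Union>i\<in>I. F i"] by simp
  also have "\<dots> \<le> k + of_nat (card I) * k"
    using insert by (intro add_mono) auto
  finally show ?case using insert by (simp add: algebra_simps)
qed

text \<open>The size of the cover depends on the ratio \<open>B\<close> of the radii only, not on
  the centre or the scale. The centres are drawn from \<open>S\<close> itself, so that a cover of a
  part of a separated set consists of points of that set.\<close>

locale doubling_space = Metric_space M d for M :: "'a set" and d +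
  assumes doubling: "\<And>B. \<exists>N::nat. \<forall>r>0. \<forall>x\<in>M. \<forall>S\<subseteq>mball x (B * r).
    \<exists>C\<subseteq>S. finite C \<and> card C \<le> N \<and> S \<subseteq> (\<Union>c\<in>C. mball c r)"
begin

lemma ball_cover:
  obtains N :: nat where "\<And>r x S. r > 0 \<Longrightarrow> x \<in> M \<Longrightarrow> S \<subseteq> mball x (B * r) \<Longrightarrow>
    \<exists>C\<subseteq>S. finite C \<and> card C \<le> N \<and> S \<subseteq> (\<Union>c\<in>C. mball c r)"
proof -
  obtain N where N: "\<forall>r>0. \<forall>x\<in>M. \<forall>S\<subseteq>mball x (B * r).
    \<exists>C\<subseteq>S. finite C \<and> card C \<le> N \<and> S \<subseteq> (\<Union>c\<in>C. mball c r)"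
    using doubling[of B] by (rule exE)
  show thesis by (rule that) (rule N[rule_format])
qed

text \<open>An \<open>r\<close>-ball holds at most \<open>N\<close> points of an
  \<open>r\<close>-separated set: cover these points by balls of radius \<open>r/2\<close> centred
  among them; each such ball contains no other point of the set than its centre. Summing over an
  optimal cover of \<open>S\<close> by \<open>r\<close>-balls gives the bound.\<close>

lemma separated_card_le:
  obtains N :: nat where "N \<ge> 1"
    "\<And>r S X. r > 0 \<Longrightarrow> X \<subseteq> S \<Longrightarrow> S \<subseteq> M \<Longrightarrow> separated d r X \<Longrightarrow> covering_number M d r S < \<infinity> \<Longrightarrow>
       finite X \<and> of_nat (card X) \<le> of_nat N * covering_number M d r S"
proof -
  obtain N :: nat where N: "\<And>r x S. r > 0 \<Longrightarrow> x \<in> M \<Longrightarrow> S \<subseteq> mball x (2 * r) \<Longrightarrow>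
    \<exists>C\<subseteq>S. finite C \<and> card C \<le> N \<and> S \<subseteq> (\<Union>c\<in>C. mball c r)"
    using ball_cover[where B = 2] by metis
  have ball: "finite (X \<inter> mball x r) \<and> card (X \<inter> mball x r) \<le> N"
    if X: "separated d r X" "r > 0" "x \<in> M" for X x r
  proof -
    obtain C where C: "C \<subseteq> X \<inter> mball x r" "finite C" "card C \<le> N"
      "X \<inter> mball x r \<subseteq> (\<Union>c\<in>C. mball c (r/2))"
      using N[of "r/2" x "X \<inter> mball x r"] X by auto
    have "y \<in> C" if y: "y \<in> X" "y \<in> mball x r" for y
    proof -
      obtain c where "c \<in> C" "d c y < r/2" using y C by auto
      moreover from this have "c = y"
        using X(1,2) y C(1) by (force simp: separated_def)
      ultimately show ?thesis by simp
    qed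
    then have "X \<inter> mball x r = C" using C(1) by auto
    then show ?thesis using C by simp
  qed
  have "finite X \<and> of_nat (card X) \<le> of_nat (max N 1) * covering_number M d r S"
    if X: "r > 0" "X \<subseteq> S" "S \<subseteq> M" "separated d r X" "covering_number M d r S < \<infinity>" for r S X
  proof -
    obtain C where C: "finite C" "C \<subseteq> M" "S \<subseteq> (\<Union>c\<in>C. mball c r)"
      "covering_number M d r S = of_nat (card C)"
      using X(5) by (rule covering_number_attained)
    have eq: "X = (\<Union>c\<in>C. X \<inter> mball c r)" using C X by auto
    have fin: "finite X"
    proof (subst eq, rule finite_UN_I[OF C(1)])
      show "finite (X \<inter> mball c r)" if "c \<in> C" for c
        using ball[OF X(4,1)] C(2) that by blast
    qed
    have "card X \<le> (\<Sum>c\<in>C. card (X \<inter> mball c r))"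
      by (subst eq) (rule card_UN_le[OF C(1)])
    also have "\<dots> \<le> (\<Sum>c\<in>C. max N 1)"
    proof (rule sum_mono)
      fix c assume "c \<in> C"
      then have "card (X \<inter> mball c r) \<le> N" using ball[OF X(4,1)] C(2) by blast
      then show "card (X \<inter> mball c r) \<le> max N 1" by simp
    qed
    finally have "card X \<le> max N 1 * card C" by (simp add: mult.commute)
    then have "(of_nat (card X) :: ennreal) \<le> of_nat (max N 1 * card C)" by (simp only: of_nat_le_iff)
    then show ?thesis using C fin by simp
  qed
  then show thesis using that[of "max N 1"] by simp
qed

text \<open>The cardinalities of separated subsets are bounded by \<open>separated_card_le\<close>,
  so one of them is largest; a point outside its \<open>r\<close>-balls could be added to
  it.\<close>

lemma ex_separated_net:
  assumes "r > 0" "S \<subseteq> M" "covering_number M d r S < \<infinity>"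
  obtains X where "finite X" "X \<subseteq> S" "separated d r X" "S \<subseteq> (\<Union>x\<in>X. mball x r)"
proof -
  obtain N :: nat where N: "\<And>X. X \<subseteq> S \<Longrightarrow> separated d r X \<Longrightarrow>
     finite X \<and> of_nat (card X) \<le> of_nat N * covering_number M d r S"
    using separated_card_le assms by metis
  obtain C :: "'a set" where C: "covering_number M d r S = of_nat (card C)"
    using assms(3) by (rule covering_number_attained)
  have bound: "finite X \<and> card X < Suc (N * card C)" if "X \<subseteq> S" "separated d r X" for X
  proof -
    have "(of_nat (card X) :: ennreal) \<le> of_nat (N * card C)" "finite X"
      using N[OF that] C by auto
    then show ?thesis by (simp only: of_nat_le_iff less_Suc_eq_le)
  qed
  have "{} \<subseteq> S \<and> separated d r {}" by (simp add: separated_def)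
  then obtain X where X: "X \<subseteq> S" "separated d r X"
    and max: "\<And>Y. Y \<subseteq> S \<and> separated d r Y \<Longrightarrow> card Y \<le> card X"
    using ex_has_greatest_nat[of "\<lambda>X. X \<subseteq> S \<and> separated d r X" "{}" card "Suc (N * card C)"] bound
    by (smt (verit) less_imp_le)
  have "S \<subseteq> (\<Union>x\<in>X. mball x r)"
  proof
    fix y assume y: "y \<in> S"
    show "y \<in> (\<Union>x\<in>X. mball x r)"
    proof (rule ccontr)
      assume n: "y \<notin> (\<Union>x\<in>X. mball x r)"
      then have far: "r \<le> d x y" if "x \<in> X" for x using that X y assms by (force simp: not_less)
      then have "y \<notin> X" using n X(1) y assms by force
      moreover have "separated d r (insert y X)"
        using X(2) far unfolding separated_def by (metis commute insert_iff)
      then have "card (insert y X) \<le> card X" using max X(1) y by blast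
      ultimately show False using bound[OF X] by simp
    qed
  qed
  then show thesis using that bound[OF X] X by blast
qed

text \<open>Passes from bounds for the parts of \<open>S\<close> in balls of radius \<open>r\<close>
  to a bound for \<open>S\<close> itself, when its diameter is comparable to \<open>r\<close>. The
  Katz-Tao conditions control such parts.\<close>

lemma covering_number_ball_le:
  obtains N :: nat where "\<And>r x S \<rho> k. r > 0 \<Longrightarrow> x \<in> M \<Longrightarrow> S \<subseteq> mball x (B * r) \<Longrightarrow>
     (\<And>c. c \<in> M \<Longrightarrow> covering_number M d \<rho> (S \<inter> mball c r) \<le> k) \<Longrightarrow>
     covering_number M d \<rho> S \<le> of_nat N * k"
proof -
  obtain N :: nat where N: "\<And>r x S. r > 0 \<Longrightarrow> x \<in> M \<Longrightarrow> S \<subseteq> mball x (B * r) \<Longrightarrow>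
    \<exists>C\<subseteq>S. finite C \<and> card C \<le> N \<and> S \<subseteq> (\<Union>c\<in>C. mball c r)"
    using ball_cover[where B = B] by metis
  have "covering_number M d \<rho> S \<le> of_nat N * k"
    if S: "r > 0" "x \<in> M" "S \<subseteq> mball x (B * r)"
      "\<And>c. c \<in> M \<Longrightarrow> covering_number M d \<rho> (S \<inter> mball c r) \<le> k" for r x S \<rho> k
  proof -
    obtain C where C: "C \<subseteq> S" "finite C" "card C \<le> N" "S \<subseteq> (\<Union>c\<in>C. mball c r)"
      using N[OF S(1-3)] by blast
    have "C \<subseteq> M" using C(1) S(3) by auto
    have "covering_number M d \<rho> S \<le> covering_number M d \<rho> (\<Union>c\<in>C. S \<inter> mball c r)"
      using C(4) by (intro covering_number_mono) auto
    also have "\<dots> \<le> of_nat (card C) * k"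
      using C(2) S(4) \<open>C \<subseteq> M\<close> by (intro covering_number_UN_le) auto
    also have "\<dots> \<le> of_nat N * k" using C(3) by (intro mult_right_mono) auto
    finally show ?thesis .
  qed
  then show thesis by (rule that)
qed

lemma covering_number_ball_finite:
  assumes "r > 0" "x \<in> M" "S \<subseteq> mball x R"
  shows "covering_number M d r S < \<infinity>"
proof -
  have "S \<subseteq> mball x (R / r * r)" using assms by simp
  then obtain C where C: "C \<subseteq> S" "finite C" "S \<subseteq> (\<Union>c\<in>C. mball c r)"
    using ball_cover[where B = "R / r"] assms(1,2) by metis
  then have "covering_number M d r S \<le> of_nat (card C)"
    using assms by (intro covering_number_le) auto
  also have "\<dots> < \<infinity>" by (simp add: of_nat_less_top)
  finally show ?thesis .
qed

end

text \<open>After rescaling by \<open>1/r\<close>, the image of any ball of radius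
  \<open>B * r\<close> lies in one fixed compact ball, so one finite net \<open>T\<close> serves all
  centres and scales.\<close>

lemma doubling_space_bilipschitz:
  fixes \<Phi> :: "'a \<Rightarrow> 'b :: euclidean_space"
  assumes "Metric_space M d" "A > 0"
    and lower: "\<And>x y. x \<in> M \<Longrightarrow> y \<in> M \<Longrightarrow> norm (\<Phi> x - \<Phi> y) \<le> A * d x y"
    and upper: "\<And>x y. x \<in> M \<Longrightarrow> y \<in> M \<Longrightarrow> d x y \<le> A * norm (\<Phi> x - \<Phi> y)"
  shows "doubling_space M d"
proof -
  interpret Metric_space M d by fact
  show ?thesis
  proof (rule doubling_space.intro[OF assms(1)], rule doubling_space_axioms.intro)
    fix B :: real
    \<comment> \<open>Two image points near the same net point are less than
      \<open>2 * \<rho>\<close> apart, and \<open>A * (2 * \<rho>) = 1\<close>.\<close>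
    define \<rho> where "\<rho> = 1 / (2 * A)"
    have \<rho>: "\<rho> > 0" using assms by (simp add: \<rho>_def)
    have "compact (cball (0::'b) (A * B))" by simp
    then have "\<forall>e>0. \<exists>T. finite T \<and> cball (0::'b) (A * B) \<subseteq> (\<Union>t\<in>T. ball t e)"
      by (rule compact_eq_totally_bounded[THEN iffD1, THEN conjunct2])
    then obtain T where T: "finite T" "cball (0::'b) (A * B) \<subseteq> (\<Union>t\<in>T. ball t \<rho>)"
      using \<rho> by blast
    show "\<exists>N::nat. \<forall>r>0. \<forall>x\<in>M. \<forall>S\<subseteq>mball x (B * r).
      \<exists>C\<subseteq>S. finite C \<and> card C \<le> N \<and> S \<subseteq> (\<Union>c\<in>C. mball c r)"
    proof (rule exI[of _ "card T"], (rule allI impI ballI)+)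
      fix r :: real and x S
      assume r: "r > 0" and x: "x \<in> M" and S: "S \<subseteq> mball x (B * r)"
      define \<Psi> where "\<Psi> y = (\<Phi> y - \<Phi> x) /\<^sub>R r" for y
      \<comment> \<open>Only net points close to the image of \<open>S\<close> are kept, and each is
        replaced by a point of \<open>S\<close>, so that the centres lie in
        \<open>S\<close>.\<close>
      define T' where "T' = {t\<in>T. \<exists>y\<in>S. \<Psi> y \<in> ball t \<rho>}"
      define sel where "sel t = (SOME y. y \<in> S \<and> \<Psi> y \<in> ball t \<rho>)" for t
      have sel: "sel t \<in> S \<and> \<Psi> (sel t) \<in> ball t \<rho>" if "t \<in> T'" for t
        unfolding sel_def using that by (rule_tac someI_ex) (auto simp: T'_def)
      have SM: "S \<subseteq> M" using S by auto
      have "y \<in> (\<Union>c\<in>sel ` T'. mball c r)" if y: "y \<in> S" for y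
      proof -
        have "norm (\<Phi> y - \<Phi> x) \<le> A * d x y"
          using lower[of x y] x y SM by (auto simp: norm_minus_commute)
        also have "\<dots> \<le> A * (B * r)" using S y assms(2) by (intro mult_left_mono) auto
        finally have "norm (\<Phi> y - \<Phi> x) / r \<le> A * B" using r by (simp add: field_simps)
        moreover have "norm (\<Psi> y) = norm (\<Phi> y - \<Phi> x) / r"
          using r by (simp add: \<Psi>_def divide_inverse mult.commute)
        ultimately have "\<Psi> y \<in> cball 0 (A * B)" by simp
        then obtain t where t: "t \<in> T" "\<Psi> y \<in> ball t \<rho>" using T by blast
        then have tT: "t \<in> T'" using y by (auto simp: T'_def)
        have "norm (\<Psi> (sel t) - \<Psi> y) < 2 * \<rho>"
          using dist_triangle_half_r[of t "\<Psi> (sel t)" "2*\<rho>" "\<Psi> y"] sel[OF tT] t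
          by (simp add: dist_norm)
        moreover have "\<Psi> (sel t) - \<Psi> y = (\<Phi> (sel t) - \<Phi> y) /\<^sub>R r"
          by (simp add: \<Psi>_def algebra_simps)
        then have "norm (\<Psi> (sel t) - \<Psi> y) = norm (\<Phi> (sel t) - \<Phi> y) / r"
          using r by (simp add: divide_inverse mult.commute)
        ultimately have "A * norm (\<Phi> (sel t) - \<Phi> y) < r"
          using r assms(2) by (simp add: \<rho>_def field_simps)
        then have "d (sel t) y < r"
          using upper[of "sel t" y] sel[OF tT] y SM by force
        then show ?thesis using sel[OF tT] y SM tT by auto
      qed
      moreover have "sel ` T' \<subseteq> S" using sel by auto
      moreover have "finite T'" "card T' \<le> card T"
        using T(1) by (auto simp: T'_def intro: card_mono)
      then have "finite (sel ` T')" "card (sel ` T') \<le> card T"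
        using card_image_le[of T' sel] by auto
      ultimately show "\<exists>C\<subseteq>S. finite C \<and> card C \<le> card T \<and> S \<subseteq> (\<Union>c\<in>C. mball c r)"
        by blast
    qed
  qed
qed

lemma doubling_space_points: "doubling_space (UNIV :: 'b::euclidean_space set) dist"
  by (rule doubling_space_bilipschitz[where \<Phi> = "\<lambda>x. x" and A = 1])
    (auto simp: dist_norm Met_TC.Metric_space_axioms)

section \<open>Lines and thin rectangles\<close>

lemma orthonormal_plane:
  fixes e f x :: "real^2"
  assumes "norm e = 1" "norm f = 1" "e \<bullet> f = 0"
  shows orthonormal_plane_expand: "x = (x \<bullet> e) *\<^sub>R e + (x \<bullet> f) *\<^sub>R f"
    and orthonormal_plane_norm: "(norm x)\<^sup>2 = (x \<bullet> e)\<^sup>2 + (x \<bullet> f)\<^sup>2"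
proof -
  have ef: "e \<bullet> e = 1" "f \<bullet> f = 1" "f \<bullet> e = 0"
    using assms by (auto simp: norm_eq_1 inner_commute)
  have ne: "e \<noteq> f" using ef assms by auto
  have orth: "pairwise orthogonal {e, f}"
    using ef assms by (auto simp: pairwise_def orthogonal_def)
  have "independent {e, f}"
    using orth by (rule pairwise_orthogonal_independent) (use ef in auto)
  then have "x \<in> span {e, f}"
    using card_eq_dim[of "{e, f}" UNIV] ne by auto
  then have "(\<Sum>v\<in>{e, f}. (x \<bullet> v) *\<^sub>R v) = x"
    using orth ef by (intro orthonormal_basis_expand[of "{e, f}"]) (auto simp: norm_eq_1)
  then show x: "x = (x \<bullet> e) *\<^sub>R e + (x \<bullet> f) *\<^sub>R f"
    using ne by simp
  have "x \<bullet> x = x \<bullet> ((x \<bullet> e) *\<^sub>R e + (x \<bullet> f) *\<^sub>R f)"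
    using x by simp
  then show "(norm x)\<^sup>2 = (x \<bullet> e)\<^sup>2 + (x \<bullet> f)\<^sup>2"
    unfolding power2_norm_eq_inner by (simp add: inner_add_right power2_eq_square)
qed

lemma ex_unit_orthogonal:
  fixes e :: "real^2"
  obtains f :: "real^2" where "norm f = 1" "e \<bullet> f = 0"
proof -
  obtain y where "y \<noteq> 0" "orthogonal e y"
    using orthogonal_to_vector_exists[of e] by auto
  then show thesis using that[of "y /\<^sub>R norm y"] by (auto simp: orthogonal_def)
qed

text \<open>For a unit vector \<open>g\<close> this is the line with normal \<open>g\<close> at
  signed distance \<open>c\<close> from the origin. In this form projection, offset and
  neighbourhood have explicit formulas.\<close>

definition line_of :: "real^2 \<Rightarrow> real \<Rightarrow> (real^2) set" where
  "line_of g c = {x. g \<bullet> x = c}"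

lemma affine_line_normal:
  assumes "l \<in> affine_lines"
  obtains g c where "norm g = 1" "l = line_of g c"
proof -
  have l: "affine hull l = l" "aff_dim l = int (DIM(real^2) - 1)"
    using assms by (auto simp: affine_lines_def affine_hull_eq[THEN iffD2])
  from aff_dim_eq_hyperplane[THEN iffD1, OF l(2)]
  obtain a b where "a \<noteq> 0" "affine hull l = {x. a \<bullet> x = b}"
    by blast
  with l(1) have ab: "a \<noteq> 0" "l = {x. a \<bullet> x = b}" by simp_all
  show thesis
  proof (rule that[of "a /\<^sub>R norm a" "b / norm a"])
    show "norm (a /\<^sub>R norm a) = 1" using ab by simp
    show "l = line_of (a /\<^sub>R norm a) (b / norm a)"
      using ab by (auto simp: line_of_def field_simps)
  qed
qed

context
  fixes g :: "real^2" and c :: real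
  assumes g: "norm g = 1"
begin

lemma offset_in_line_of: "c *\<^sub>R g \<in> line_of g c"
  using g by (simp add: line_of_def norm_eq_1)

lemma affine_line_of: "affine (line_of g c)"
  unfolding line_of_def by (rule affine_hyperplane)

lemma direction_line_of: "direction (line_of g c) = {x. g \<bullet> x = 0}"
proof -
  have "{x - y | x y. x \<in> line_of g c \<and> y \<in> line_of g c} = {x. g \<bullet> x = 0}"
  proof safe
    fix z assume "g \<bullet> z = 0"
    then have "z + c *\<^sub>R g \<in> line_of g c"
      using g by (simp add: line_of_def inner_add_right norm_eq_1)
    then show "\<exists>x y. z = x - y \<and> x \<in> line_of g c \<and> y \<in> line_of g c"
      using offset_in_line_of by (intro exI[of _ "z + c *\<^sub>R g"] exI[of _ "c *\<^sub>R g"]) simp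
  qed (simp add: line_of_def inner_diff_right)
  then show ?thesis
    by (simp add: direction_def span_eq_iff subspace_hyperplane)
qed

lemma orth_proj_line_of: "orth_proj (direction (line_of g c)) x = x - (g \<bullet> x) *\<^sub>R g"
  unfolding direction_line_of using g
  by (intro orth_proj_eqI subspace_hyperplane)
    (auto simp: orthogonal_comp_def orthogonal_def inner_diff_right norm_eq_1 inner_commute)

lemma line_offset_line_of: "line_offset (line_of g c) = c *\<^sub>R g"
  by (intro line_offset_eqI affine_line_of offset_in_line_of)
    (auto simp: direction_line_of orthogonal_comp_def orthogonal_def inner_commute)

lemma nbhd_line_of: "x \<in> nbhd (line_of g c) r \<longleftrightarrow> \<bar>g \<bullet> x - c\<bar> < r"
proof
  assume "x \<in> nbhd (line_of g c) r"
  then obtain y where y: "g \<bullet> y = c" "norm (y - x) < r"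
    by (auto simp: nbhd_def line_of_def dist_norm)
  have "\<bar>g \<bullet> (y - x)\<bar> \<le> norm g * norm (y - x)" by (rule Cauchy_Schwarz_ineq2)
  then show "\<bar>g \<bullet> x - c\<bar> < r" using y g by (simp add: inner_diff_right)
next
  assume r: "\<bar>g \<bullet> x - c\<bar> < r"
  \<comment> \<open>The foot of the perpendicular from \<open>x\<close>.\<close>
  have "x - (g \<bullet> x - c) *\<^sub>R g \<in> line_of g c"
    using g by (simp add: line_of_def inner_diff_right norm_eq_1)
  moreover have "x \<in> ball (x - (g \<bullet> x - c) *\<^sub>R g) r"
    using r g by (simp add: dist_norm)
  ultimately show "x \<in> nbhd (line_of g c) r" unfolding nbhd_def by (rule UN_I)
qed

end

section \<open>Bounds for the metric on lines\<close>

lemma line_dist_ge: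
  "norm (orth_proj (direction l) x - orth_proj (direction l') x) \<le> line_dist l l' * norm x"
  "norm (line_offset l - line_offset l') \<le> line_dist l l'"
proof -
  have "norm (orth_proj (direction l) x - orth_proj (direction l') x)
    \<le> onorm (\<lambda>x. orth_proj (direction l) x - orth_proj (direction l') x) * norm x"
    by (rule onorm[OF bounded_linear_proj_diff])
  also have "\<dots> \<le> line_dist l l' * norm x"
    unfolding line_dist_def by (intro mult_right_mono) auto
  finally show "norm (orth_proj (direction l) x - orth_proj (direction l') x) \<le> line_dist l l' * norm x" .
  show "norm (line_offset l - line_offset l') \<le> line_dist l l'"
    unfolding line_dist_def using onorm_pos_le[OF bounded_linear_proj_diff[of l l']] by simp
qed

lemma line_dist_le:
  assumes "\<And>x. norm (orth_proj (direction l) x - orth_proj (direction l') x) \<le> A * norm x"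
    and "norm (line_offset l - line_offset l') \<le> B"
  shows "line_dist l l' \<le> A + B"
  unfolding line_dist_def using assms by (intro add_mono onorm_le)

text \<open>The operator norm of a linear map of the plane is comparable to its size on the two axis
  vectors. So a line is represented, with bi-Lipschitz constant \<open>3\<close>, by the two values
  of its projection there together with its offset.\<close>

lemma doubling_space_lines: "doubling_space affine_lines line_dist"
proof (rule doubling_space_bilipschitz[OF Metric_space_lines])
  let ?p = "\<lambda>l i. orth_proj (direction l) (axis i 1)"
  let ?\<Phi> = "\<lambda>l. (?p l 1, ?p l 2, line_offset l)"
  show "(3::real) > 0" by simp
  fix l l'
  have "norm (?p l i - ?p l' i) \<le> line_dist l l'" for i
    using line_dist_ge(1)[of l "axis i 1" l'] by simp
  from this[of 1] this[of 2]
  show "norm (?\<Phi> l - ?\<Phi> l') \<le> 3 * line_dist l l'"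
    using line_dist_ge(2)[of l l'] norm_Pair_le[of "?p l 1 - ?p l' 1" "(?p l 2 - ?p l' 2, line_offset l - line_offset l')"]
      norm_Pair_le[of "?p l 2 - ?p l' 2" "line_offset l - line_offset l'"] by simp
  define D where "D = norm (?\<Phi> l - ?\<Phi> l')"
  have D: "norm (?p l 1 - ?p l' 1) \<le> D" "norm (?p l 2 - ?p l' 2) \<le> D"
    "norm (line_offset l - line_offset l') \<le> D"
    unfolding D_def diff_Pair by (meson norm_fst_le norm_snd_le order_trans)+
  have "line_dist l l' \<le> 2 * D + D"
  proof (rule line_dist_le)
    fix x :: "real^2"
    define T where "T x = orth_proj (direction l) x - orth_proj (direction l') x" for x
    have T: "linear T" unfolding T_def
      using bounded_linear_proj_diff by (rule bounded_linear.linear)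
    have "x = x $ 1 *\<^sub>R axis 1 1 + x $ 2 *\<^sub>R axis 2 1"
      by (simp add: vec_eq_iff axis_def forall_2)
    then have "T x = x $ 1 *\<^sub>R T (axis 1 1) + x $ 2 *\<^sub>R T (axis 2 1)"
      using linear_add[OF T] linear_scale[OF T] by metis
    then have "norm (T x) \<le> \<bar>x $ 1\<bar> * norm (T (axis 1 1)) + \<bar>x $ 2\<bar> * norm (T (axis 2 1))"
      using norm_triangle_ineq by (metis norm_scaleR)
    also have "\<dots> \<le> norm x * D + norm x * D"
      using D component_le_norm_cart[of x] by (intro add_mono mult_mono) (auto simp: T_def)
    finally show "norm (orth_proj (direction l) x - orth_proj (direction l') x) \<le> 2 * D * norm x"
      by (simp add: T_def algebra_simps)
  qed (rule D)
  then show "line_dist l l' \<le> 3 * norm (?\<Phi> l - ?\<Phi> l')" unfolding D_def by simp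
qed

text \<open>The vector \<open>(g \<bullet> x - c) *\<^sub>R g\<close> from the line to
  \<open>x\<close> is \<open>x\<close> minus its projection minus the offset. Passing to another
  line changes it by the difference of the projections at \<open>x\<close> and that of the offsets,
  which correspond to the two terms of the metric; \<open>1 \<le> b\<close> allows the factor
  \<open>b\<close> on the second term too.\<close>

lemma line_dist_close:
  assumes g: "norm g = 1" "norm g' = 1" and x: "norm x \<le> b" "1 \<le> b"
  shows "\<bar>g' \<bullet> x - c'\<bar> \<le> \<bar>g \<bullet> x - c\<bar> + b * line_dist (line_of g c) (line_of g' c')"
proof -
  let ?\<pi> = "orth_proj (direction (line_of g c)) x" and ?\<pi>' = "orth_proj (direction (line_of g' c')) x"
  let ?T = "\<lambda>x. orth_proj (direction (line_of g c)) x - orth_proj (direction (line_of g' c')) x"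
  have "(g' \<bullet> x - c') *\<^sub>R g' = (g \<bullet> x - c) *\<^sub>R g + ((?\<pi> - ?\<pi>') + (c *\<^sub>R g - c' *\<^sub>R g'))"
    using g by (simp add: orth_proj_line_of algebra_simps)
  then have "norm ((g' \<bullet> x - c') *\<^sub>R g')
      \<le> norm ((g \<bullet> x - c) *\<^sub>R g) + (norm (?\<pi> - ?\<pi>') + norm (c *\<^sub>R g - c' *\<^sub>R g'))"
    using norm_triangle_ineq[of "(g \<bullet> x - c) *\<^sub>R g" "(?\<pi> - ?\<pi>') + (c *\<^sub>R g - c' *\<^sub>R g')"]
      norm_triangle_ineq[of "?\<pi> - ?\<pi>'" "c *\<^sub>R g - c' *\<^sub>R g'"] by simp
  then have "\<bar>g' \<bullet> x - c'\<bar> \<le> \<bar>g \<bullet> x - c\<bar> + (norm (?\<pi> - ?\<pi>') + norm (c *\<^sub>R g - c' *\<^sub>R g'))"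
    using g by simp
  moreover have "norm (?\<pi> - ?\<pi>') \<le> onorm ?T * norm x"
    by (rule onorm[OF bounded_linear_proj_diff])
  moreover have "onorm ?T * norm x \<le> onorm ?T * b"
    using x(1) by (intro mult_left_mono onorm_pos_le[OF bounded_linear_proj_diff])
  moreover have "norm (c *\<^sub>R g - c' *\<^sub>R g') * 1 \<le> norm (c *\<^sub>R g - c' *\<^sub>R g') * b"
    using x(2) by (intro mult_left_mono) auto
  moreover have "b * line_dist (line_of g c) (line_of g' c') = onorm ?T * b + norm (c *\<^sub>R g - c' *\<^sub>R g') * b"
    using g by (simp only: line_dist_def line_offset_line_of) (simp add: algebra_simps)
  ultimately show ?thesis by linarith
qed

text \<open>Shows that the lines meeting a bounded set form a bounded family: normal projections
  have norm at most \<open>1\<close>, and the offset is the normal part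
  \<open>(g \<bullet> x) *\<^sub>R g\<close> of any point \<open>x\<close> of the line.\<close>

lemma line_dist_meeting:
  assumes l: "l \<in> affine_lines" "l' \<in> affine_lines" and x: "x \<in> l" "x' \<in> l'" "norm x \<le> b" "norm x' \<le> b"
  shows "line_dist l l' \<le> 2 + 2 * b"
proof (rule line_dist_le)
  obtain g c where g: "norm g = 1" "l = line_of g c" using l affine_line_normal by blast
  obtain g' c' where g': "norm g' = 1" "l' = line_of g' c'" using l affine_line_normal by blast
  have *: "norm ((h \<bullet> y) *\<^sub>R h) \<le> norm y" if "norm h = 1" for h y :: "real^2"
    using Cauchy_Schwarz_ineq2[of h y] that by simp
  show "norm (orth_proj (direction l) y - orth_proj (direction l') y) \<le> 2 * norm y" for y
  proof -
    have "orth_proj (direction l) y - orth_proj (direction l') y = (g' \<bullet> y) *\<^sub>R g' - (g \<bullet> y) *\<^sub>R g"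
      using g g' by (simp add: orth_proj_line_of)
    then show ?thesis
      using *[OF g(1), of y] *[OF g'(1), of y] norm_triangle_ineq4[of "(g' \<bullet> y) *\<^sub>R g'" "(g \<bullet> y) *\<^sub>R g"]
      by simp
  qed
  show "norm (line_offset l - line_offset l') \<le> 2 * b"
  proof -
    have "line_offset l = (g \<bullet> x) *\<^sub>R g" "line_offset l' = (g' \<bullet> x') *\<^sub>R g'"
      using x(1,2) g g' by (simp_all add: line_offset_line_of) (simp_all add: line_of_def)
    then show ?thesis
      using *[OF g(1), of x] *[OF g'(1), of x'] x(3,4)
        norm_triangle_ineq4[of "(g \<bullet> x) *\<^sub>R g" "(g' \<bullet> x') *\<^sub>R g'"]
      by simp
  qed
qed

text \<open>A rectangle given by its centre and half side lengths, as it will be built around a net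
  point \<open>x\<close>; later on \<open>f\<close> is the long direction.\<close>

definition tube :: "real^2 \<Rightarrow> real^2 \<Rightarrow> real^2 \<Rightarrow> real \<Rightarrow> real \<Rightarrow> (real^2) set" where
  "tube x e f a b = {x + u *\<^sub>R e + v *\<^sub>R f | u v. \<bar>u\<bar> \<le> a \<and> \<bar>v\<bar> \<le> b}"

lemma is_rectangle_tube:
  assumes "norm e = 1" "norm f = 1" "e \<bullet> f = 0"
  shows "is_rectangle (2 * a) (2 * b) (tube x e f a b)"
proof -
  have "tube x e f a b = {(x - a *\<^sub>R e - b *\<^sub>R f) + u *\<^sub>R e + v *\<^sub>R f | u v. 0 \<le> u \<and> u \<le> 2 * a \<and> 0 \<le> v \<and> v \<le> 2 * b}"
  proof (intro equalityI subsetI)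
    fix y assume "y \<in> tube x e f a b"
    then obtain u v where "y = x + u *\<^sub>R e + v *\<^sub>R f" "\<bar>u\<bar> \<le> a" "\<bar>v\<bar> \<le> b"
      by (auto simp: tube_def)
    then have "y = (x - a *\<^sub>R e - b *\<^sub>R f) + (u + a) *\<^sub>R e + (v + b) *\<^sub>R f" 
      "0 \<le> u + a" "u + a \<le> 2 * a" "0 \<le> v + b" "v + b \<le> 2 * b"
      by (auto simp: algebra_simps)
    then show "y \<in> {(x - a *\<^sub>R e - b *\<^sub>R f) + u *\<^sub>R e + v *\<^sub>R f | u v. 0 \<le> u \<and> u \<le> 2 * a \<and> 0 \<le> v \<and> v \<le> 2 * b}"
      by blast
  next
    fix y assume "y \<in> {(x - a *\<^sub>R e - b *\<^sub>R f) + u *\<^sub>R e + v *\<^sub>R f | u v. 0 \<le> u \<and> u \<le> 2 * a \<and> 0 \<le> v \<and> v \<le> 2 * b}"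
    then obtain u v where "y = (x - a *\<^sub>R e - b *\<^sub>R f) + u *\<^sub>R e + v *\<^sub>R f"
      "0 \<le> u" "u \<le> 2 * a" "0 \<le> v" "v \<le> 2 * b" by blast
    then have "y = x + (u - a) *\<^sub>R e + (v - b) *\<^sub>R f" "\<bar>u - a\<bar> \<le> a" "\<bar>v - b\<bar> \<le> b"
      by (auto simp: algebra_simps)
    then show "y \<in> tube x e f a b" unfolding tube_def by blast
  qed
  then show ?thesis using assms unfolding is_rectangle_def by blast
qed

text \<open>In the next three lemmas, \<open>x\<close> and \<open>x + \<rho> *\<^sub>R f\<close> are two points of the net near the line
  at distance \<open>\<rho>\<close> comparable to \<open>m * \<delta>\<close>, so that the line makes an angle \<open>O(1 / m)\<close> with \<open>f\<close>.
  For small \<open>m\<close> the tube is a square and the direction is irrelevant.\<close>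

lemma angle_bound:
  assumes "\<bar>g \<bullet> x - c\<bar> \<le> 3 * \<delta>" "\<bar>g \<bullet> (x + \<rho> *\<^sub>R f) - c\<bar> \<le> 3 * \<delta>" "m * \<delta> \<le> 2 * \<rho>" "0 < m" "0 < \<delta>"
  shows "m * \<bar>g \<bullet> f\<bar> \<le> 12"
proof -
  have \<rho>: "\<rho> > 0" using assms mult_pos_pos[of m \<delta>] by linarith
  have "\<bar>\<rho> * (g \<bullet> f)\<bar> \<le> 6 * \<delta>" using assms(1,2) by (simp add: inner_add_right)
  then have "2 * \<rho> * \<bar>g \<bullet> f\<bar> \<le> 12 * \<delta>" using \<rho> by (simp add: abs_mult)
  moreover have "m * \<delta> * \<bar>g \<bullet> f\<bar> \<le> 2 * \<rho> * \<bar>g \<bullet> f\<bar>" using assms(3) by (intro mult_right_mono) auto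
  ultimately have "(m * \<bar>g \<bullet> f\<bar>) * \<delta> \<le> 12 * \<delta>" by (simp add: algebra_simps)
  then show ?thesis using assms(5) by simp
qed

lemma tube_subset_nbhd:
  assumes ef: "norm e = 1" "norm f = 1" "e \<bullet> f = 0" and g: "norm g = 1"
    and \<delta>: "\<delta> > 0" and m: "m > 0" and x: "\<bar>g \<bullet> x - c\<bar> \<le> 3 * \<delta>"
    and x': "m < 25 \<or> (m * \<delta> \<le> 2 * \<rho> \<and> \<bar>g \<bullet> (x + \<rho> *\<^sub>R f) - c\<bar> \<le> 3 * \<delta>)"
    and \<Delta>: "\<Delta> = max \<delta> (m * \<delta> / 25)"
  shows "tube x e f (50 * \<delta>) (50 * \<Delta>) \<subseteq> nbhd (line_of g c) (100 * \<delta>)"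
proof
  fix z assume "z \<in> tube x e f (50 * \<delta>) (50 * \<Delta>)"
  then obtain u v where z: "z = x + u *\<^sub>R e + v *\<^sub>R f" and uv: "\<bar>u\<bar> \<le> 50 * \<delta>" "\<bar>v\<bar> \<le> 50 * \<Delta>"
    by (auto simp: tube_def)
  have ge: "\<bar>g \<bullet> e\<bar> \<le> 1" using Cauchy_Schwarz_ineq2[of g e] ef g by simp
  \<comment> \<open>The bound \<open>74\<close> covers both cases: \<open>50\<close> times the
    square root of \<open>2\<close> for the square, and \<open>50 + 24\<close> for the long tube.
    Adding the \<open>3\<close> from \<open>x\<close> stays below \<open>100\<close>.\<close>
  have "\<bar>g \<bullet> (u *\<^sub>R e + v *\<^sub>R f)\<bar> \<le> 74 * \<delta>"
  proof (cases "m < 25")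
    case True
    then have "\<Delta> = \<delta>" using \<delta> by (simp add: \<Delta>)
    have "(norm (u *\<^sub>R e + v *\<^sub>R f))\<^sup>2 = u\<^sup>2 + v\<^sup>2"
      using orthonormal_plane_norm[OF ef, of "u *\<^sub>R e + v *\<^sub>R f"] ef inner_commute[of f e]
      by (simp add: inner_add_left norm_eq_1)
    also have "\<dots> \<le> (50 * \<delta>)\<^sup>2 + (50 * \<delta>)\<^sup>2"
      using uv \<open>\<Delta> = \<delta>\<close> \<delta> by (intro add_mono; subst abs_le_square_iff[symmetric]) auto
    also have "\<dots> \<le> (74 * \<delta>)\<^sup>2" by (simp add: power2_eq_square)
    finally have "norm (u *\<^sub>R e + v *\<^sub>R f) \<le> 74 * \<delta>"
      using \<delta> by (rule_tac power2_le_imp_le) auto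
    then show ?thesis using Cauchy_Schwarz_ineq2[of g "u *\<^sub>R e + v *\<^sub>R f"] g by simp
  next
    case False
    then have \<Delta>': "\<Delta> = m * \<delta> / 25" using \<delta> by (simp add: \<Delta>)
    have "m * \<bar>g \<bullet> f\<bar> \<le> 12" using x' x False m \<delta> by (intro angle_bound[of g x c \<delta> \<rho> f]) auto
    then have "\<delta> * (m * \<bar>g \<bullet> f\<bar>) \<le> \<delta> * 12" using \<delta> by (intro mult_left_mono) auto
    moreover have "\<bar>v\<bar> * \<bar>g \<bullet> f\<bar> \<le> (2 * (m * \<delta>)) * \<bar>g \<bullet> f\<bar>"
    proof (rule mult_right_mono)
      show "\<bar>v\<bar> \<le> 2 * (m * \<delta>)" using uv(2) \<Delta>' by linarith
    qed simp
    ultimately have "\<bar>v * (g \<bullet> f)\<bar> \<le> 24 * \<delta>" by (simp add: abs_mult algebra_simps)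
    moreover have "\<bar>u\<bar> * \<bar>g \<bullet> e\<bar> \<le> (50 * \<delta>) * 1" using uv(1) ge \<delta> by (intro mult_mono) auto
    then have "\<bar>u * (g \<bullet> e)\<bar> \<le> 50 * \<delta>" by (simp add: abs_mult)
    ultimately show ?thesis by (simp add: inner_add_right)
  qed
  moreover have "g \<bullet> z = g \<bullet> x + g \<bullet> (u *\<^sub>R e + v *\<^sub>R f)" unfolding z by (simp add: inner_add_right)
  ultimately show "z \<in> nbhd (line_of g c) (100 * \<delta>)"
    using x \<delta> by (simp add: nbhd_line_of[OF g])
qed

lemma point_in_tube:
  assumes ef: "norm e = 1" "norm f = 1" "e \<bullet> f = 0" and g: "norm g = 1"
    and \<delta>: "\<delta> > 0" and m: "m > 0" and x: "\<bar>g \<bullet> x - c\<bar> \<le> 3 * \<delta>"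
    and x': "m < 25 \<or> (m * \<delta> \<le> 2 * \<rho> \<and> \<bar>g \<bullet> (x + \<rho> *\<^sub>R f) - c\<bar> \<le> 3 * \<delta>)"
    and \<Delta>: "\<Delta> = max \<delta> (m * \<delta> / 25)"
    and y: "\<bar>g \<bullet> y - c\<bar> \<le> 3 * \<delta>" "dist x y \<le> 2 * (m * \<delta>)"
  shows "y \<in> tube x e f (50 * \<delta>) (50 * \<Delta>)"
proof -
  define u where "u = (y - x) \<bullet> e"
  define v where "v = (y - x) \<bullet> f"
  have eq: "y = x + u *\<^sub>R e + v *\<^sub>R f"
    using orthonormal_plane_expand[OF ef, of "y - x"] by (simp add: u_def v_def algebra_simps)
  have yx: "norm (y - x) \<le> 2 * (m * \<delta>)" using y(2) by (simp add: dist_norm norm_minus_commute)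
  have "\<bar>u\<bar> \<le> norm (y - x)" "\<bar>v\<bar> \<le> norm (y - x)"
    using Cauchy_Schwarz_ineq2[of "y - x" e] Cauchy_Schwarz_ineq2[of "y - x" f] ef
    by (auto simp: u_def v_def)
  with yx have uv: "\<bar>u\<bar> \<le> 2 * (m * \<delta>)" "\<bar>v\<bar> \<le> 2 * (m * \<delta>)" by linarith+
  then have "\<bar>v\<bar> \<le> 50 * \<Delta>" by (simp add: \<Delta>)
  moreover have "\<bar>u\<bar> \<le> 50 * \<delta>"
  proof (cases "m < 25")
    case True
    then have "m * \<delta> \<le> 25 * \<delta>" using \<delta> by (intro mult_right_mono) auto
    then show ?thesis using uv(1) by linarith
  next
    case False
    \<comment> \<open>As \<open>m \<ge> 25\<close>, the component of \<open>g\<close> along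
      \<open>f\<close> is at most \<open>12/25\<close>, so \<open>g\<close> is nearly parallel to
      \<open>e\<close>. Then \<open>\<bar>u * (g \<bullet> e)\<bar>\<close> is at most
      \<open>(3 + 3 + 24) * \<delta>\<close>, and division by \<open>3/5\<close> gives
      \<open>50 * \<delta>\<close>.\<close>
    have norm_g: "(g \<bullet> e)\<^sup>2 + (g \<bullet> f)\<^sup>2 = 1" using orthonormal_plane_norm[OF ef, of g] g by simp
    have mgf: "m * \<bar>g \<bullet> f\<bar> \<le> 12" using x' x False m \<delta> by (intro angle_bound[of g x c \<delta> \<rho> f]) auto
    have "25 * \<bar>g \<bullet> f\<bar> \<le> m * \<bar>g \<bullet> f\<bar>" using False by (intro mult_right_mono) auto
    with mgf have "\<bar>g \<bullet> f\<bar> \<le> 1/2" by linarith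
    then have "(g \<bullet> f)\<^sup>2 \<le> (1/2)\<^sup>2" by (simp only: abs_le_square_iff[symmetric])
    then have "(3/5)\<^sup>2 \<le> (g \<bullet> e)\<^sup>2" using norm_g by (simp add: power2_eq_square)
    then have ge: "3/5 \<le> \<bar>g \<bullet> e\<bar>" by (simp only: abs_le_square_iff[symmetric])
    have "\<bar>v\<bar> * \<bar>g \<bullet> f\<bar> \<le> (2 * (m * \<delta>)) * \<bar>g \<bullet> f\<bar>" using uv(2) by (intro mult_right_mono) auto
    moreover have "\<delta> * (m * \<bar>g \<bullet> f\<bar>) \<le> \<delta> * 12" using \<delta> mgf by (intro mult_left_mono) auto
    ultimately have "\<bar>v * (g \<bullet> f)\<bar> \<le> 24 * \<delta>" by (simp add: abs_mult algebra_simps)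
    moreover have "g \<bullet> y = g \<bullet> x + u * (g \<bullet> e) + v * (g \<bullet> f)"
      by (subst eq) (simp add: inner_add_right)
    ultimately have "\<bar>u * (g \<bullet> e)\<bar> \<le> 30 * \<delta>" using x y(1) by linarith
    moreover have "\<bar>u\<bar> * (3/5) \<le> \<bar>u\<bar> * \<bar>g \<bullet> e\<bar>" using ge by (intro mult_left_mono) auto
    ultimately show ?thesis by (simp add: abs_mult)
  qed
  ultimately show ?thesis unfolding tube_def using eq by blast
qed

text \<open>If \<open>g\<close> is almost orthogonal to \<open>f\<close>, it is close to
  \<open>e\<close> or \<open>-e\<close>: with the right sign \<open>s\<close>, the square of
  \<open>norm (g - s *\<^sub>R e)\<close> is \<open>2 - 2 * \<bar>g \<bullet> e\<bar>\<close>, which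
  is at most \<open>2 * (g \<bullet> f)\<^sup>2\<close>. The sign cancels in the projection onto the
  normal.\<close>

lemma proj_normal_close:
  fixes g f e x :: "real^2"
  assumes ef: "norm e = 1" "norm f = 1" "e \<bullet> f = 0" and g: "norm g = 1" and \<eta>: "\<bar>g \<bullet> f\<bar> \<le> \<eta>"
  shows "norm ((g \<bullet> x) *\<^sub>R g - (e \<bullet> x) *\<^sub>R e) \<le> 4 * \<eta> * norm x"
proof -
  define s :: real where "s = (if g \<bullet> e \<ge> 0 then 1 else -1)"
  have s: "s * s = 1" "s * (g \<bullet> e) = \<bar>g \<bullet> e\<bar>" by (auto simp: s_def)
  define d where "d = g - s *\<^sub>R e"
  have "\<bar>g \<bullet> e\<bar> \<le> 1" using Cauchy_Schwarz_ineq2[of g e] ef g by simp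
  then have "(g \<bullet> e)\<^sup>2 \<le> \<bar>g \<bullet> e\<bar>"
    by (metis abs_ge_zero mult_left_le power2_abs power2_eq_square)
  moreover have "(g \<bullet> e)\<^sup>2 + (g \<bullet> f)\<^sup>2 = 1" using orthonormal_plane_norm[OF ef, of g] g by simp
  moreover have "(norm d)\<^sup>2 = g \<bullet> g - 2 * (s * (g \<bullet> e)) + (s * s) * (e \<bullet> e)"
    unfolding d_def power2_norm_eq_inner by (simp add: inner_diff_left inner_diff_right inner_commute algebra_simps)
  ultimately have "(norm d)\<^sup>2 \<le> 2 * (g \<bullet> f)\<^sup>2" using s ef g by (simp add: norm_eq_1)
  also have "\<dots> \<le> (2 * (g \<bullet> f))\<^sup>2" by (simp add: power2_eq_square)
  also have "\<dots> \<le> (2 * \<eta>)\<^sup>2" using \<eta> by (subst abs_le_square_iff[symmetric]) auto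
  finally have d: "norm d \<le> 2 * \<eta>" using \<eta> by (rule_tac power2_le_imp_le) auto
  have gd: "g = s *\<^sub>R e + d" by (simp add: d_def)
  \<comment> \<open>Inserting \<open>s * s = 1\<close> makes it possible to write the difference as
    two terms, each linear in \<open>d\<close>.\<close>
  have "(g \<bullet> x) *\<^sub>R g - (e \<bullet> x) *\<^sub>R e = (g \<bullet> x) *\<^sub>R g - (s * s) *\<^sub>R ((e \<bullet> x) *\<^sub>R e)" using s by simp
  also have "\<dots> = (d \<bullet> x) *\<^sub>R g + (s * (e \<bullet> x)) *\<^sub>R d"
    unfolding d_def by (simp add: algebra_simps)
  finally have "norm ((g \<bullet> x) *\<^sub>R g - (e \<bullet> x) *\<^sub>R e) \<le> \<bar>d \<bullet> x\<bar> + \<bar>s\<bar> * \<bar>e \<bullet> x\<bar> * norm d"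
    using norm_triangle_ineq[of "(d \<bullet> x) *\<^sub>R g" "(s * (e \<bullet> x)) *\<^sub>R d"] g by (simp add: abs_mult)
  also have "\<dots> \<le> norm d * norm x + 1 * norm x * norm d"
    using Cauchy_Schwarz_ineq2[of d x] Cauchy_Schwarz_ineq2[of e x] ef
    by (intro add_mono mult_mono) (auto simp: s_def)
  also have "\<dots> \<le> 4 * \<eta> * norm x" using mult_right_mono[OF d, of "norm x"] by simp
  finally show ?thesis .
qed

text \<open>Both lines pass within \<open>100 * \<delta>\<close> of two points of the long axis at
  distance \<open>50 * \<Delta>\<close>, so both make an angle \<open>O(\<delta> / \<Delta>)\<close>
  with \<open>f\<close>. As they also pass near the bounded point \<open>x\<close>, their offsets
  are close to the same order.\<close>

lemma line_dist_tube_le: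
  assumes ef: "norm e = 1" "norm f = 1" "e \<bullet> f = 0" and \<delta>: "0 < \<delta>" "0 < \<Delta>" "\<Delta> \<le> 2"
    and x: "norm x \<le> 2"
    and l: "l \<in> affine_lines" "tube x e f (50 * \<delta>) (50 * \<Delta>) \<subseteq> nbhd l (100 * \<delta>)"
    and l': "l' \<in> affine_lines" "tube x e f (50 * \<delta>) (50 * \<Delta>) \<subseteq> nbhd l' (100 * \<delta>)"
  shows "line_dist l l' < 1000 * (\<delta> / \<Delta>)"
proof -
  \<comment> \<open>Here \<open>4 = 200 / 50\<close>: two errors of \<open>100 * \<delta>\<close>
    over the distance \<open>50 * \<Delta>\<close>.\<close>
  define \<eta> where "\<eta> = 4 * (\<delta> / \<Delta>)"
  obtain g c where g: "norm g = 1" "l = line_of g c" using l affine_line_normal by blast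
  obtain g' c' where g': "norm g' = 1" "l' = line_of g' c'" using l' affine_line_normal by blast
  \<comment> \<open>The two points used are the centre and one end of the long axis.\<close>
  have mem: "x + u *\<^sub>R e + v *\<^sub>R f \<in> tube x e f (50 * \<delta>) (50 * \<Delta>)" if "u = 0" "v = 0 \<or> v = 50 * \<Delta>" for u v
  proof -
    have "\<bar>u\<bar> \<le> 50 * \<delta>" "\<bar>v\<bar> \<le> 50 * \<Delta>" using that \<delta> by auto
    then show ?thesis unfolding tube_def by blast
  qed
  have *: "\<bar>h \<bullet> x - b\<bar> < 100 * \<delta> \<and> \<bar>h \<bullet> f\<bar> \<le> \<eta>"
    if h: "norm h = 1" "tube x e f (50 * \<delta>) (50 * \<Delta>) \<subseteq> nbhd (line_of h b) (100 * \<delta>)" for h b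
  proof -
    have "x + 0 *\<^sub>R e + 0 *\<^sub>R f \<in> nbhd (line_of h b) (100 * \<delta>)"
      "x + 0 *\<^sub>R e + (50 * \<Delta>) *\<^sub>R f \<in> nbhd (line_of h b) (100 * \<delta>)"
      using h(2) mem by blast+
    then have a: "\<bar>h \<bullet> x - b\<bar> < 100 * \<delta>" "\<bar>h \<bullet> x + 50 * \<Delta> * (h \<bullet> f) - b\<bar> < 100 * \<delta>"
      by (simp_all add: nbhd_line_of[OF h(1)] inner_add_right)
    then have "\<bar>50 * \<Delta> * (h \<bullet> f)\<bar> \<le> 200 * \<delta>" by linarith
    then have "\<bar>h \<bullet> f\<bar> \<le> \<eta>" using \<delta> by (simp add: \<eta>_def abs_mult field_simps)
    with a show ?thesis by simp
  qed
  have hg: "\<bar>g \<bullet> x - c\<bar> < 100 * \<delta>" "\<bar>g \<bullet> f\<bar> \<le> \<eta>" using *[of g c] g l by auto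
  have hg': "\<bar>g' \<bullet> x - c'\<bar> < 100 * \<delta>" "\<bar>g' \<bullet> f\<bar> \<le> \<eta>" using *[of g' c'] g' l' by auto
  have close: "norm ((g' \<bullet> y) *\<^sub>R g' - (g \<bullet> y) *\<^sub>R g) \<le> 8 * \<eta> * norm y" for y
    using proj_normal_close[OF ef g(1) hg(2), of y] proj_normal_close[OF ef g'(1) hg'(2), of y]
      norm_triangle_ineq4[of "(g' \<bullet> y) *\<^sub>R g' - (e \<bullet> y) *\<^sub>R e" "(g \<bullet> y) *\<^sub>R g - (e \<bullet> y) *\<^sub>R e"]
    by simp
  have "line_dist l l' \<le> 8 * \<eta> + (16 * \<eta> + 200 * \<delta>)"
  proof (rule line_dist_le)
    show "norm (orth_proj (direction l) y - orth_proj (direction l') y) \<le> 8 * \<eta> * norm y" for y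
      using close[of y] g g' by (simp add: orth_proj_line_of)
    have "8 * \<eta> * norm x \<le> 8 * \<eta> * 2" using x \<delta> by (intro mult_left_mono) (auto simp: \<eta>_def)
    then have x16: "norm ((g' \<bullet> x) *\<^sub>R g' - (g \<bullet> x) *\<^sub>R g) \<le> 16 * \<eta>" using close[of x] by linarith
    \<comment> \<open>The offset is the normal part of \<open>x\<close> up to the distance from
      \<open>x\<close> to the line.\<close>
    have "c *\<^sub>R g - c' *\<^sub>R g' = ((g' \<bullet> x - c') *\<^sub>R g' - (g \<bullet> x - c) *\<^sub>R g) - ((g' \<bullet> x) *\<^sub>R g' - (g \<bullet> x) *\<^sub>R g)"
      by (simp add: algebra_simps)
    then have "norm (c *\<^sub>R g - c' *\<^sub>R g') \<le> norm ((g' \<bullet> x - c') *\<^sub>R g' - (g \<bullet> x - c) *\<^sub>R g) + 16 * \<eta>"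
      using x16 norm_triangle_ineq4 by (smt (verit))
    also have "norm ((g' \<bullet> x - c') *\<^sub>R g' - (g \<bullet> x - c) *\<^sub>R g) \<le> \<bar>g' \<bullet> x - c'\<bar> + \<bar>g \<bullet> x - c\<bar>"
      using norm_triangle_ineq4[of "(g' \<bullet> x - c') *\<^sub>R g'" "(g \<bullet> x - c) *\<^sub>R g"] g g' by simp
    finally show "norm (line_offset l - line_offset l') \<le> 16 * \<eta> + 200 * \<delta>"
      using hg hg' g g' by (simp add: line_offset_line_of)
  qed
  \<comment> \<open>Because \<open>\<Delta> \<le> 2\<close>, the total is at most
    \<open>(24 * 4 + 400) * (\<delta> / \<Delta>)\<close>.\<close>
  moreover have "\<delta> \<le> 2 * (\<delta> / \<Delta>)" using \<delta> by (simp add: field_simps)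
  moreover have "\<delta> / \<Delta> > 0" using \<delta> by simp
  ultimately show ?thesis unfolding \<eta>_def by linarith
qed

section \<open>Pigeonholing over scales\<close>

text \<open>Let \<open>f k\<close> be the largest number of points of \<open>X\<close> in a ball of
  radius \<open>2^k * \<delta>\<close> centred in \<open>X\<close>. If \<open>f k\<close> is at
  least half of \<open>card X\<close> and exceeds \<open>f (k - 1)\<close> by
  \<open>card X / (2 * K)\<close>, a ball attaining \<open>f k\<close> works: around each of its
  points, the ball of half the radius misses at least that many of its points. For
  \<open>k = 0\<close> every pair counts, including the diagonal ones.\<close>

lemma scale_selection:
  fixes X :: "'a::metric_space set"
  assumes X: "finite X" "X \<noteq> {}" and \<delta>: "\<delta> > 0" and K: "K \<ge> 1"
    and diam: "\<And>x y. x \<in> X \<Longrightarrow> y \<in> X \<Longrightarrow> dist x y < 2^K * \<delta>"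
  obtains k Q where "k \<le> K" "Q \<subseteq> X" "card X \<le> 2 * card Q"
    "\<And>x y. x \<in> Q \<Longrightarrow> y \<in> Q \<Longrightarrow> dist x y < 2 * (2^k * \<delta>)"
    "(card X)\<^sup>2 \<le> 4 * K * card {(x, y) \<in> Q \<times> Q. k = 0 \<or> 2^k * \<delta> \<le> 2 * dist x y}"
proof -
  define n where "n = card X"
  define F where "F k x = X \<inter> ball x (2^k * \<delta>)" for k x
  define f where "f k = Max ((\<lambda>x. card (F k x)) ` X)" for k
  have F_le: "card (F k x) \<le> f k" if "x \<in> X" for k x
    unfolding f_def using X that by (intro Max_ge) auto
  have F_att: "\<exists>x\<in>X. f k = card (F k x)" for k
  proof -
    have "f k \<in> (\<lambda>x. card (F k x)) ` X" unfolding f_def using X by (intro Max_in) auto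
    then show ?thesis by auto
  qed
  have top: "f K = n"
  proof -
    obtain x where "x \<in> X" "f K = card (F K x)" using F_att by blast
    moreover have "F K x = X" using \<open>x \<in> X\<close> diam by (auto simp: F_def)
    ultimately show ?thesis by (simp add: n_def)
  qed
  \<comment> \<open>The jumps of \<open>f\<close> telescope to at most \<open>n\<close>, so either some jump is at least \<open>n / (2 * K)\<close>, and we
    stop at the last such jump, or none is and we may take \<open>k = 0\<close>; in both cases \<open>f k\<close> has not yet
    dropped below \<open>n / 2\<close>.\<close>
  define slow where "slow k \<longleftrightarrow> (\<forall>j. k < j \<and> j \<le> K \<longrightarrow> 2 * K * f j < 2 * K * f (j - 1) + n)" for k
  define k where "k = (LEAST k. slow k)"
  have "slow K" by (simp add: slow_def)
  then have slow: "slow k" and kK: "k \<le> K"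
    unfolding k_def by (auto intro: LeastI Least_le)
  \<comment> \<open>Descending from \<open>K\<close> to \<open>k\<close> takes at most
    \<open>K\<close> steps, each losing less than \<open>n / (2 * K)\<close> from
    \<open>f K = n\<close>. The factor \<open>2 * K\<close> keeps the count in the natural
    numbers.\<close>
  have "2 * K * n \<le> 2 * K * f (K - i) + i * n" if "i \<le> K - k" for i
    using that
  proof (induction i)
    case 0
    then show ?case by (simp add: top)
  next
    case (Suc i)
    have "2 * K * f (K - i) < 2 * K * f (K - i - 1) + n"
      using slow Suc.prems unfolding slow_def by (elim allE[of _ "K - i"]) auto
    moreover have "2 * K * n \<le> 2 * K * f (K - i) + i * n" using Suc by simp
    ultimately show ?case by simp
  qed
  from this[of "K - k"] have "2 * K * n \<le> 2 * K * f k + (K - k) * n" using kK by simp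
  also have "\<dots> \<le> 2 * K * f k + K * n" by simp
  finally have "K * n \<le> K * (2 * f k)" by simp
  then have half: "n \<le> 2 * f k" using K by simp
  obtain x where x: "x \<in> X" "f k = card (F k x)" using F_att by blast
  define Q where "Q = F k x"
  have Q: "Q \<subseteq> X" "finite Q" "card Q = f k" using X x by (auto simp: Q_def F_def)
  define G where "G y = {z \<in> Q. k = 0 \<or> 2^k * \<delta> \<le> 2 * dist y z}" for y
  have G: "n \<le> 2 * K * card (G y)" if "y \<in> Q" for y
  proof (cases "k = 0")
    case True
    then have "card (G y) = f k" using Q by (simp add: G_def)
    then have "n \<le> 2 * card (G y)" using half by simp
    also have "\<dots> \<le> 2 * K * card (G y)" using K by simp
    finally show ?thesis .
  next
    case False
    \<comment> \<open>Minimality of \<open>k\<close> gives a large jump after \<open>k - 1\<close>,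
      and slowness of \<open>k\<close> excludes every place after \<open>k\<close>.\<close>
    then have "\<not> slow (k - 1)" unfolding k_def by (intro not_less_Least) auto
    then obtain j where j: "k - 1 < j" "j \<le> K" "2 * K * f j \<ge> 2 * K * f (j - 1) + n"
      unfolding slow_def by (auto simp: not_less)
    have "j = k"
    proof (rule ccontr)
      assume "j \<noteq> k"
      then have "k < j" using j by simp
      then show False using slow j unfolding slow_def by auto
    qed
    have pow: "(2::real)^k = 2 * 2^(k - 1)" using False by (cases k) auto
    \<comment> \<open>Points of \<open>Q\<close> that are not far from \<open>y\<close> lie in the
      ball of half the radius about \<open>y\<close>, which holds at most \<open>f (k - 1)\<close>
      points.\<close>
    have "Q \<subseteq> G y \<union> F (k - 1) y" using Q(1) by (auto simp: G_def F_def pow)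
    moreover have "finite (G y)" "finite (F (k - 1) y)" using X Q by (auto simp: G_def F_def)
    ultimately have "card Q \<le> card (G y) + card (F (k - 1) y)"
      by (meson card_Un_le card_mono finite_UnI order_trans)
    also have "\<dots> \<le> card (G y) + f (k - 1)" using F_le that Q by auto
    finally have "f k \<le> card (G y) + f (k - 1)" using Q by simp
    then have "2 * K * f k \<le> 2 * K * (card (G y) + f (k - 1))" by simp
    then show ?thesis using j \<open>j = k\<close> by (simp add: algebra_simps)
  qed
  have eq: "{(x, y) \<in> Q \<times> Q. k = 0 \<or> 2^k * \<delta> \<le> 2 * dist x y} = Sigma Q G"
    by (auto simp: G_def)
  have "n\<^sup>2 \<le> 2 * f k * n" using half by (simp add: power2_eq_square)
  also have "\<dots> = 2 * (\<Sum>y\<in>Q. n)" using Q by simp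
  also have "\<dots> \<le> 2 * (\<Sum>y\<in>Q. 2 * K * card (G y))" using G by (intro mult_left_mono sum_mono) auto
  also have "\<dots> = 4 * K * card (Sigma Q G)"
    using Q by (simp add: card_SigmaI G_def sum_distrib_left mult.assoc)
  finally have pairs: "n\<^sup>2 \<le> 4 * K * card (Sigma Q G)" .
  show thesis
  proof (rule that[OF kK Q(1)])
    show "card X \<le> 2 * card Q" using half Q by (simp add: n_def)
    show "dist y z < 2 * (2^k * \<delta>)" if "y \<in> Q" "z \<in> Q" for y z
      using dist_triangle_half_r[of x y "2 * (2^k * \<delta>)" z] that by (simp add: Q_def F_def)
    show "(card X)\<^sup>2 \<le> 4 * K * card {(x, y) \<in> Q \<times> Q. k = 0 \<or> 2^k * \<delta> \<le> 2 * dist x y}"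
      using pairs unfolding eq n_def .
  qed
qed

text \<open>Double counting over triples \<open>(x, x', k)\<close>. At least
  \<open>\<tau> * card Y / 2\<close> elements of \<open>Y\<close> are heavy, each of them has at
  least \<open>\<tau>\<^sup>2 * (card X)\<^sup>2 / (16 * K)\<close> separated pairs at its own
  scale, and there are \<open>(card X)\<^sup>2 * (K + 1)\<close> triples; the average is the bound
  claimed for \<open>Z\<close>.\<close>

lemma rich_pair:
  fixes X :: "'a::metric_space set" and Y :: "'b set" and near :: "'a \<Rightarrow> 'b \<Rightarrow> bool" and \<tau> :: real
  assumes X: "finite X" "X \<noteq> {}" and Y: "finite Y" "Y \<noteq> {}" and \<tau>: "\<tau> > 0"
    and many: "\<tau> * card X * card Y \<le> card {(x, l) \<in> X \<times> Y. near x l}"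
    and \<delta>: "\<delta> > 0" and K: "K \<ge> 1"
    and diam: "\<And>x y. x \<in> X \<Longrightarrow> y \<in> X \<Longrightarrow> dist x y < 2^K * \<delta>"
  obtains k x x' Z Q l where "k \<le> K" "x \<in> X" "x' \<in> X" "Z \<subseteq> Y" "Q \<subseteq> X" "l \<in> Z"
    "\<tau>^3 * card Y \<le> 32 * K * (K + 1) * card Z" "\<tau> * card X \<le> 4 * card Q"
    "\<forall>l'\<in>Z. near x l' \<and> near x' l'"
    "k = 0 \<or> 2^k * \<delta> \<le> 2 * dist x x'"
    "\<forall>y\<in>Q. near y l \<and> dist x y < 2 * (2^k * \<delta>)"
proof -
  define P where "P l = {x \<in> X. near x l}" for l
  define H where "H = {l \<in> Y. \<tau> * card X \<le> 2 * card (P l)}"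
  have cX: "card X > 0" using X by (simp add: card_gt_0_iff)
  have cY: "card Y > 0" using Y by (simp add: card_gt_0_iff)
  have finP: "finite (P l)" and PX: "card (P l) \<le> card X" for l
    using X by (auto simp: P_def intro: card_mono)
  have finH: "finite H" "H \<subseteq> Y" using Y by (auto simp: H_def)
  have heavy: "\<tau> * card Y \<le> 2 * card H"
  proof -
    have "{(x, l) \<in> X \<times> Y. near x l} = (\<lambda>(l, x). (x, l)) ` Sigma Y P"
      by (auto simp: P_def image_iff)
    then have "card {(x, l) \<in> X \<times> Y. near x l} = card (Sigma Y P)"
      by (simp add: card_image inj_on_def)
    also have "\<dots> = (\<Sum>l\<in>Y. card (P l))" using Y finP by simp
    \<comment> \<open>Light elements have at most \<open>\<tau> * card X / 2\<close> near points
      each, hence together at most half of the required total; heavy ones have at most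
      \<open>card X\<close> each.\<close>
    also have "real \<dots> \<le> (\<Sum>l\<in>Y. (if l \<in> H then real (card X) else 0) + \<tau> * card X / 2)"
      unfolding of_nat_sum
    proof (rule sum_mono)
      fix l assume "l \<in> Y"
      then show "real (card (P l)) \<le> (if l \<in> H then real (card X) else 0) + \<tau> * card X / 2"
        using PX[of l] \<tau> by (auto simp: H_def add_increasing2)
    qed
    also have "\<dots> = card H * card X + card Y * (\<tau> * card X / 2)"
      using Y finH by (simp add: sum.distrib sum.If_cases Int_absorb1)
    finally have "\<tau> * card X * card Y \<le> card H * card X + card Y * (\<tau> * card X / 2)"
      using many by linarith
    then have "(\<tau> * card Y) * card X \<le> (2 * card H) * real (card X)"
      by (simp add: algebra_simps)
    then show ?thesis using cX by simp
  qed
  define good where "good l k Q \<longleftrightarrow> k \<le> K \<and> Q \<subseteq> P l \<and> card (P l) \<le> 2 * card Q \<and>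
      (\<forall>x\<in>Q. \<forall>y\<in>Q. dist x y < 2 * (2^k * \<delta>)) \<and>
      (card (P l))\<^sup>2 \<le> 4 * K * card {(x, y) \<in> Q \<times> Q. k = 0 \<or> 2^k * \<delta> \<le> 2 * dist x y}" for l k Q
  have "\<exists>k Q. good l k Q" if "l \<in> H" for l
  proof -
    have "0 < \<tau> * card X" using \<tau> cX by simp
    also have "\<dots> \<le> 2 * card (P l)" using that by (simp add: H_def)
    finally have "P l \<noteq> {}" by auto
    then obtain k Q where "k \<le> K" "Q \<subseteq> P l" "card (P l) \<le> 2 * card Q"
      "\<And>x y. x \<in> Q \<Longrightarrow> y \<in> Q \<Longrightarrow> dist x y < 2 * (2^k * \<delta>)"
      "(card (P l))\<^sup>2 \<le> 4 * K * card {(x, y) \<in> Q \<times> Q. k = 0 \<or> 2^k * \<delta> \<le> 2 * dist x y}"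
      using scale_selection[OF finP _ \<delta> K, of l] diam by (auto simp: P_def)
    then show ?thesis unfolding good_def by blast
  qed
  then obtain kk QQ where good: "\<And>l. l \<in> H \<Longrightarrow> good l (kk l) (QQ l)" by metis
  define W where "W l = {(x, y) \<in> QQ l \<times> QQ l. kk l = 0 \<or> 2^(kk l) * \<delta> \<le> 2 * dist x y}" for l
  have QX: "QQ l \<subseteq> X" "finite (QQ l)" if "l \<in> H" for l
    using good[OF that] finP[of l] by (auto simp: good_def P_def intro: finite_subset)
  have finW: "finite (W l)" if "l \<in> H" for l
    unfolding W_def by (rule finite_subset[of _ "QQ l \<times> QQ l"]) (use QX[OF that] in auto)
  have W: "\<tau>\<^sup>2 * (card X)\<^sup>2 \<le> 16 * K * card (W l)" if "l \<in> H" for l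
  proof -
    have "(\<tau> * card X)\<^sup>2 \<le> (2 * real (card (P l)))\<^sup>2"
      using that \<tau> by (intro power_mono) (auto simp: H_def)
    moreover have "real ((card (P l))\<^sup>2) \<le> real (4 * K * card (W l))"
      using good[OF that] unfolding good_def W_def by (simp only: of_nat_le_iff)
    ultimately show ?thesis by (simp add: power_mult_distrib)
  qed
  define Z where "Z = (\<lambda>(x, x', k). {l \<in> H. kk l = k \<and> (x, x') \<in> W l})"
  define T where "T = X \<times> X \<times> {..K}"
  have "\<exists>t\<in>T. \<tau>^3 * card Y \<le> 32 * K * (K + 1) * card (Z t)"
  proof (rule ccontr)
    assume "\<not> ?thesis"
    then have "real (32 * K * (K + 1) * card (Z t)) < \<tau>^3 * card Y" if "t \<in> T" for t
      using that by (meson not_le)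
    then have small: "32 * real K * real (K + 1) * card (Z t) < \<tau>^3 * card Y" if "t \<in> T" for t
      using that by (simp only: of_nat_mult of_nat_numeral)
    have T: "finite T" "T \<noteq> {}" "card T = (card X)\<^sup>2 * (K + 1)"
      using X by (auto simp: T_def power2_eq_square algebra_simps)
    \<comment> \<open>The scale is a function of \<open>l\<close>, so \<open>l\<close> and one of
      its separated pairs determine the triple that counts them.\<close>
    have "Sigma H W \<subseteq> (\<Union>t\<in>T. Z t \<times> {(fst t, fst (snd t))})"
    proof (rule subsetI, clarify)
      fix l x x' assume l: "l \<in> H" "(x, x') \<in> W l"
      then have "(x, x', kk l) \<in> T" "l \<in> Z (x, x', kk l)"
        using QX[OF l(1)] good[OF l(1)] by (auto simp: T_def Z_def W_def good_def)
      then show "(l, x, x') \<in> (\<Union>t\<in>T. Z t \<times> {(fst t, fst (snd t))})" by force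
    qed
    moreover have finZ: "finite (Z t)" for t using finH by (auto simp: Z_def split: prod.splits)
    then have "finite (\<Union>t\<in>T. Z t \<times> {(fst t, fst (snd t))})" using T by auto
    ultimately have "card (Sigma H W) \<le> card (\<Union>t\<in>T. Z t \<times> {(fst t, fst (snd t))})"
      by (intro card_mono)
    also have "\<dots> \<le> (\<Sum>t\<in>T. card (Z t \<times> {(fst t, fst (snd t))}))" by (rule card_UN_le[OF T(1)])
    also have "\<dots> = (\<Sum>t\<in>T. card (Z t))" by (simp add: card_cartesian_product)
    finally have "(\<Sum>l\<in>H. card (W l)) \<le> (\<Sum>t\<in>T. card (Z t))" using finH finW by simp
    then have "real (\<Sum>l\<in>H. card (W l)) \<le> real (\<Sum>t\<in>T. card (Z t))" by (simp only: of_nat_le_iff)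
    then have "32 * real K * real (K + 1) * (\<Sum>l\<in>H. real (card (W l)))
        \<le> 32 * real K * real (K + 1) * (\<Sum>t\<in>T. real (card (Z t)))"
      by (intro mult_left_mono) auto
    also have "\<dots> = (\<Sum>t\<in>T. 32 * real K * real (K + 1) * card (Z t))" by (simp only: sum_distrib_left)
    also have "\<dots> < (\<Sum>t\<in>T. \<tau>^3 * card Y)"
      using T small by (intro sum_strict_mono) auto
    also have "\<dots> = (\<tau>\<^sup>2 * (card X)\<^sup>2 * (K + 1)) * (\<tau> * card Y)"
      using T by (simp add: power2_eq_square power3_eq_cube algebra_simps)
    also have "\<dots> \<le> (\<tau>\<^sup>2 * (card X)\<^sup>2 * (K + 1)) * real (2 * card H)"
      using heavy by (intro mult_left_mono) auto
    also have "\<dots> = 2 * real (K + 1) * (\<Sum>l\<in>H. \<tau>\<^sup>2 * (card X)\<^sup>2)" by simp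
    also have "\<dots> \<le> 2 * real (K + 1) * (\<Sum>l\<in>H. real (16 * K * card (W l)))"
      using W by (intro mult_left_mono sum_mono) auto
    also have "(\<Sum>l\<in>H. real (16 * K * card (W l))) = 16 * real K * (\<Sum>l\<in>H. real (card (W l)))"
      by (simp add: sum_distrib_left mult.assoc)
    finally show False by (simp add: algebra_simps)
  qed
  then obtain x x' k where t: "(x, x', k) \<in> T" "\<tau>^3 * card Y \<le> 32 * K * (K + 1) * card (Z (x, x', k))"
    by (metis prod_cases3)
  have "0 < \<tau>^3 * card Y" using \<tau> cY by simp
  then have "Z (x, x', k) \<noteq> {}" using t(2) by fastforce
  \<comment> \<open>Any \<open>l\<close> in \<open>Z\<close> serves: its set \<open>QQ l\<close>
    contains \<open>x\<close> and at least half of the points near \<open>l\<close>, at the common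
    scale \<open>k\<close>.\<close>
  then obtain l where l: "l \<in> Z (x, x', k)" by blast
  then have lH: "l \<in> H" "kk l = k" "(x, x') \<in> W l" by (auto simp: Z_def)
  show thesis
  proof (rule that[of k x x' "Z (x, x', k)" "QQ l" l])
    show "k \<le> K" "x \<in> X" "x' \<in> X" using t(1) by (auto simp: T_def)
    show "Z (x, x', k) \<subseteq> Y" using finH by (auto simp: Z_def)
    show "QQ l \<subseteq> X" "l \<in> Z (x, x', k)" using QX lH l by auto
    show "\<tau>^3 * card Y \<le> 32 * K * (K + 1) * card (Z (x, x', k))" by (rule t)
    have "card (P l) \<le> 2 * card (QQ l)" using good[OF lH(1)] by (simp add: good_def)
    then show "\<tau> * card X \<le> 4 * card (QQ l)" using lH(1) by (simp add: H_def)
    show "\<forall>l'\<in>Z (x, x', k). near x l' \<and> near x' l'"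
    proof
      fix l' assume "l' \<in> Z (x, x', k)"
      then show "near x l' \<and> near x' l'"
        using good[of l'] by (auto simp: Z_def W_def good_def P_def)
    qed
    show "k = 0 \<or> 2^k * \<delta> \<le> 2 * dist x x'" using lH by (auto simp: W_def)
    show "\<forall>y\<in>QQ l. near y l \<and> dist x y < 2 * (2^k * \<delta>)"
      using good[OF lH(1)] lH by (auto simp: W_def good_def P_def)
  qed
qed

section \<open>Cliques\<close>

lemma unit_square:
  fixes x y :: "real^2"
  assumes "x \<in> {x. \<forall>i. 0 \<le> x $ i \<and> x $ i < 1}" "y \<in> {x. \<forall>i. 0 \<le> x $ i \<and> x $ i < 1}"
  shows dist_unit_square: "dist x y < 2" and norm_unit_square: "norm x < 2"
proof -
  have c: "0 \<le> x $ i" "x $ i < 1" "0 \<le> y $ i" "y $ i < 1" for i using assms by auto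
  have "norm (x - y) \<le> \<bar>x $ 1 - y $ 1\<bar> + \<bar>x $ 2 - y $ 2\<bar>"
    using norm_le_l1_cart[of "x - y"] by (simp add: sum_2)
  then show "dist x y < 2" using c[of 1] c[of 2] by (simp add: dist_norm)
  have "norm x \<le> \<bar>x $ 1\<bar> + \<bar>x $ 2\<bar>"
    using norm_le_l1_cart[of x] by (simp add: sum_2)
  then show "norm x < 2" using c[of 1] c[of 2] by simp
qed

text \<open>An incidence \<open>(p, l)\<close> is within \<open>\<delta>\<close> of
  \<open>(x, y)\<close> for centres \<open>x\<close> near \<open>p\<close> and \<open>y\<close> near
  \<open>l\<close>, since the metric is a maximum. Then \<open>p\<close> is within
  \<open>2 * \<delta>\<close> of \<open>y\<close>, because \<open>norm p \<le> 2\<close>, and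
  \<open>x\<close> within \<open>3 * \<delta>\<close>. Only lines that meet \<open>P\<close> must be
  covered by \<open>Y\<close>, so that the bound applies before \<open>\<L>\<close> is known to have
  a finite cover.\<close>

lemma incidence_cov_le:
  assumes \<delta>: "\<delta> > 0" and P: "P \<subseteq> ball 0 2" "P \<subseteq> (\<Union>x\<in>X. ball x \<delta>)" and X: "finite X"
    and L: "\<L> \<subseteq> affine_lines" "{l \<in> \<L>. l \<inter> P \<noteq> {}} \<subseteq> (\<Union>y\<in>Y. Lines.mball y \<delta>)"
    and Y: "finite Y" "Y \<subseteq> affine_lines"
  shows "incidence_cov \<delta> (incidences P \<L>) \<le> of_nat (card {(x, y) \<in> X \<times> Y. x \<in> nbhd y (3 * \<delta>)})"
proof (rule covering_number_le)
  show "finite {(x, y) \<in> X \<times> Y. x \<in> nbhd y (3 * \<delta>)}"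
    by (rule finite_subset[of _ "X \<times> Y"]) (use X Y in auto)
  show "{(x, y) \<in> X \<times> Y. x \<in> nbhd y (3 * \<delta>)} \<subseteq> UNIV \<times> affine_lines" using Y by auto
  show "incidences P \<L> \<subseteq> (\<Union>c\<in>{(x, y) \<in> X \<times> Y. x \<in> nbhd y (3 * \<delta>)}.
    Metric_space.mball (UNIV \<times> affine_lines) incidence_dist c \<delta>)"
  proof
    fix z assume "z \<in> incidences P \<L>"
    then obtain p l where z: "z = (p, l)" and p: "p \<in> P" "l \<in> \<L>" "p \<in> l"
      by (auto simp: incidences_def)
    obtain x where x: "x \<in> X" "dist x p < \<delta>" using P p by auto
    obtain y where y: "y \<in> Y" "y \<in> affine_lines" "l \<in> affine_lines" "line_dist y l < \<delta>"
      using L p by fastforce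
    obtain g c where g: "norm g = 1" "l = line_of g c" using y affine_line_normal by blast
    obtain g' c' where g': "norm g' = 1" "y = line_of g' c'" using y affine_line_normal by blast
    have "\<bar>g' \<bullet> p - c'\<bar> \<le> \<bar>g \<bullet> p - c\<bar> + 2 * line_dist (line_of g c) (line_of g' c')"
      using p P by (intro line_dist_close[OF g(1) g'(1)]) auto
    also have "g \<bullet> p - c = 0" using p g by (simp add: line_of_def)
    finally have "\<bar>g' \<bullet> p - c'\<bar> < 2 * \<delta>" using y g g' by (simp add: Lines.commute)
    moreover have "\<bar>g' \<bullet> (x - p)\<bar> \<le> dist x p"
      using Cauchy_Schwarz_ineq2[of g' "x - p"] g' by (simp add: dist_norm)
    ultimately have "\<bar>g' \<bullet> x - c'\<bar> < 3 * \<delta>" using x by (simp add: inner_diff_right)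
    then have "x \<in> nbhd y (3 * \<delta>)" using g' by (simp add: nbhd_line_of)
    moreover have "z \<in> Metric_space.mball (UNIV \<times> affine_lines) incidence_dist (x, y) \<delta>"
      using x y unfolding z Metric_space.in_mball[OF Metric_space_incidence]
      by (simp add: incidence_dist_def)
    ultimately show "z \<in> (\<Union>c\<in>{(x, y) \<in> X \<times> Y. x \<in> nbhd y (3 * \<delta>)}.
      Metric_space.mball (UNIV \<times> affine_lines) incidence_dist c \<delta>)"
      using x y by blast
  qed
qed

text \<open>Incidences involve only lines that meet \<open>P\<close>, which form a bounded family,
  so their covering number is finite. The clique inequality passes this on to \<open>\<L>\<close>,
  as the factor in front of \<open>line_cov \<delta> \<L>\<close> is not zero.\<close>

lemma clique_cov_finite:
  assumes \<delta>: "\<delta> > 0" and P: "P \<noteq> {}" "P \<subseteq> ball 0 2" and \<theta>: "\<theta> > 0" and clique: "clique \<delta> \<theta> P \<L>"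
  shows "point_cov \<delta> P < \<infinity>" "line_cov \<delta> \<L> < \<infinity>"
proof -
  show covP: "point_cov \<delta> P < \<infinity>"
    using doubling_space.covering_number_ball_finite[OF doubling_space_points \<delta>, of 0 P 2] P by simp
  then obtain X where X: "finite X" "P \<subseteq> (\<Union>x\<in>X. ball x \<delta>)"
    by (rule covering_number_attained) simp
  have L: "\<L> \<subseteq> affine_lines" using clique by (simp add: clique_def)
  define M where "M = {l \<in> \<L>. l \<inter> P \<noteq> {}}"
  have "line_cov \<delta> M < \<infinity>"
  proof (cases "M = {}")
    case True
    then show ?thesis by (simp add: covering_number_empty)
  next
    case False
    then obtain l0 where l0: "l0 \<in> M" by blast
    \<comment> \<open>\<open>line_dist_meeting\<close> with \<open>b = 2\<close> gives at most
      \<open>6\<close>.\<close>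
    have "line_dist l0 l < 7" if l: "l \<in> M" for l
    proof -
      obtain x x' where "x \<in> l0" "x \<in> P" "x' \<in> l" "x' \<in> P" using l l0 by (auto simp: M_def)
      moreover from this have "norm x \<le> 2" "norm x' \<le> 2" using P by auto
      ultimately have "line_dist l0 l \<le> 2 + 2 * 2"
        using l l0 L by (intro line_dist_meeting[of _ _ x x']) (auto simp: M_def)
      then show ?thesis by simp
    qed
    moreover have "M \<subseteq> affine_lines" using L by (auto simp: M_def)
    ultimately have "M \<subseteq> Lines.mball l0 7" "l0 \<in> affine_lines" using l0 by auto
    then show ?thesis
      using \<delta> by (intro doubling_space.covering_number_ball_finite[OF doubling_space_lines])
  qed
  then obtain Y where Y: "finite Y" "Y \<subseteq> affine_lines" "M \<subseteq> (\<Union>y\<in>Y. Lines.mball y \<delta>)"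
    by (rule covering_number_attained)
  have "ennreal \<theta> * point_cov \<delta> P * line_cov \<delta> \<L> \<le> incidence_cov \<delta> (incidences P \<L>)"
    using clique by (simp add: clique_def)
  also have "\<dots> \<le> of_nat (card {(x, y) \<in> X \<times> Y. x \<in> nbhd y (3 * \<delta>)})"
    using \<delta> P X L Y by (intro incidence_cov_le) (auto simp: M_def)
  also have "\<dots> < \<infinity>" by (simp add: of_nat_less_top)
  finally have fin: "ennreal \<theta> * point_cov \<delta> P * line_cov \<delta> \<L> < top" by simp
  have "point_cov \<delta> P \<noteq> 0" using covering_number_ge_1[OF P(1)] by (metis not_one_le_zero)
  then have "ennreal \<theta> * point_cov \<delta> P \<noteq> 0" using \<theta> by simp
  then show "line_cov \<delta> \<L> < \<infinity>" using fin by (auto simp: ennreal_mult_less_top)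
qed

text \<open>The common core of both halves of the theorem. The rectangle is kept as a tube with
  explicit centre and axes, which the Katz-Tao counts refer to.\<close>

lemma clique_tube:
  obtains C1 :: real where "C1 \<ge> 2"
    "\<forall>n \<delta> \<theta> P \<L>. \<delta> = (1/2)^n \<longrightarrow> n \<ge> 1 \<longrightarrow> 0 < \<theta> \<longrightarrow> \<theta> \<le> 1 \<longrightarrow> P \<noteq> {} \<longrightarrow>
      P \<subseteq> {x. \<forall>i. 0 \<le> x $ i \<and> x $ i < 1} \<longrightarrow> \<L> \<noteq> {} \<longrightarrow> clique \<delta> \<theta> P \<L> \<longrightarrow>
      (\<exists>\<Delta> x e f. norm e = 1 \<and> norm f = 1 \<and> e \<bullet> f = 0 \<and> norm x \<le> 2 \<and> \<delta> \<le> \<Delta> \<and> \<Delta> \<le> 2 \<and>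
        ennreal (inverse C1 * \<theta>^2) * point_cov \<delta> P
          \<le> point_cov \<delta> (P \<inter> tube x e f (50 * \<delta>) (50 * \<Delta>)) \<and>
        ennreal (inverse C1 * log 2 (1/\<delta>) powr (- C1) * \<theta>^4) * line_cov \<delta> \<L>
          \<le> line_cov \<delta> {l \<in> \<L>. tube x e f (50 * \<delta>) (50 * \<Delta>) \<subseteq> nbhd l (100 * \<delta>)})"
proof -
  obtain NP :: nat where NP: "NP \<ge> 1"
    "\<And>r S X. r > 0 \<Longrightarrow> X \<subseteq> S \<Longrightarrow> separated dist r X \<Longrightarrow> point_cov r S < \<infinity> \<Longrightarrow>
       finite X \<and> of_nat (card X) \<le> of_nat NP * point_cov r S"
    using doubling_space.separated_card_le[OF doubling_space_points] by (metis subset_UNIV)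
  obtain NL :: nat where NL: "NL \<ge> 1"
    "\<And>r S X. r > 0 \<Longrightarrow> X \<subseteq> S \<Longrightarrow> S \<subseteq> affine_lines \<Longrightarrow> separated line_dist r X \<Longrightarrow> line_cov r S < \<infinity> \<Longrightarrow>
       finite X \<and> of_nat (card X) \<le> of_nat NL * line_cov r S"
    using doubling_space.separated_card_le[OF doubling_space_lines] by metis
  \<comment> \<open>\<open>A\<close> bounds the loss in passing from covering numbers to the sizes
    of the two nets.\<close>
  define A where "A = real NP * real NL"
  have A: "A \<ge> 1" "real NP \<ge> 1" "real NL \<ge> 1"
    using NP(1) NL(1) mult_mono[of 1 "real NP" 1 "real NL"] by (auto simp: A_def)
  \<comment> \<open>\<open>192 = 32 * 2 * 3\<close>, as \<open>n + 1 \<le> 2 * n\<close> and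
    \<open>n + 2 \<le> 3 * n\<close>. The cube of \<open>A\<close> comes from
    \<open>\<tau>^3\<close>, and the last factor pays for returning from separated sets to covering
    numbers.\<close>
  define C1 where "C1 = 192 * A^3 * (real NP * real NL)"
  have C1: "C1 \<ge> 2" "C1 \<ge> 4 * NP * A" "C1 \<ge> 192 * A^3 * NL"
  proof -
    have A3: "A \<le> A^3" "1 \<le> A^3" using A self_le_power[of A 3] by auto
    have "1 * 1 \<le> A^3 * A" using A A3 by (intro mult_mono) auto
    moreover have "C1 = 192 * (A^3 * A)" by (simp add: C1_def A_def)
    ultimately show "C1 \<ge> 2" by linarith
    have "A^3 * NL * 1 \<le> A^3 * NL * NP" using A by (intro mult_left_mono) auto
    then show "C1 \<ge> 192 * A^3 * NL" by (simp add: C1_def mult_ac)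
    have "NP * (A * 1) \<le> NP * (A^3 * NL)" using A A3 by (intro mult_left_mono mult_mono) auto
    moreover have "0 \<le> NP * (A^3 * NL)" using A by simp
    ultimately show "C1 \<ge> 4 * NP * A" by (simp add: C1_def mult_ac)
  qed
  show thesis
  proof (rule that[OF C1(1)], intro allI impI)
    fix n and \<delta> \<theta> :: real and P \<L>
    assume \<delta>n: "\<delta> = (1/2)^n" and n: "n \<ge> 1" and \<theta>: "0 < \<theta>" "\<theta> \<le> 1" and P: "P \<noteq> {}"
      and sq: "P \<subseteq> {x. \<forall>i. 0 \<le> x $ i \<and> x $ i < 1}" and "\<L> \<noteq> {}" and clique: "clique \<delta> \<theta> P \<L>"
    have \<delta>: "\<delta> > 0" by (simp add: \<delta>n)
    have P2: "P \<subseteq> ball 0 2" using norm_unit_square sq by fastforce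
    have L: "\<L> \<subseteq> affine_lines" using clique by (simp add: clique_def)
    note fin = clique_cov_finite[OF \<delta> P P2 \<theta>(1) clique]

    \<comment> \<open>Nets of points and lines\<close>
    obtain X where X: "finite X" "X \<subseteq> P" "separated dist \<delta> X" "P \<subseteq> (\<Union>x\<in>X. ball x \<delta>)"
      using doubling_space.ex_separated_net[OF doubling_space_points \<delta> _ fin(1)] by auto
    obtain Y where Y: "finite Y" "Y \<subseteq> \<L>" "separated line_dist \<delta> Y" "\<L> \<subseteq> (\<Union>y\<in>Y. Lines.mball y \<delta>)"
      using doubling_space.ex_separated_net[OF doubling_space_lines \<delta> L fin(2)] by auto
    have XY: "X \<noteq> {}" "Y \<noteq> {}" using X(4) Y(4) P \<open>\<L> \<noteq> {}\<close> by auto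
    obtain a where a: "point_cov \<delta> P = of_nat a" using fin(1) by (rule covering_number_attained)
    obtain b where b: "line_cov \<delta> \<L> = of_nat b" using fin(2) by (rule covering_number_attained)
    have "of_nat a \<le> (of_nat (card X) :: ennreal)"
      unfolding a[symmetric] using X by (intro covering_number_le) auto
    then have aX: "a \<le> card X" by (simp only: of_nat_le_iff)
    have "of_nat b \<le> (of_nat (card Y) :: ennreal)"
      unfolding b[symmetric] using Y L by (intro covering_number_le) auto
    then have bY: "b \<le> card Y" by (simp only: of_nat_le_iff)
    have "of_nat (card X) \<le> (of_nat (NP * a) :: ennreal)"
      using NP(2)[OF \<delta> X(2,3) fin(1)] by (simp add: a)
    then have Xa: "card X \<le> NP * a" by (simp only: of_nat_le_iff)
    have "of_nat (card Y) \<le> (of_nat (NL * b) :: ennreal)"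
      using NL(2)[OF \<delta> Y(2) L Y(3) fin(2)] by (simp add: b)
    then have Yb: "card Y \<le> NL * b" by (simp only: of_nat_le_iff)
    define J where "J = {(x, y) \<in> X \<times> Y. x \<in> nbhd y (3 * \<delta>)}"
    have "ennreal \<theta> * point_cov \<delta> P * line_cov \<delta> \<L> \<le> incidence_cov \<delta> (incidences P \<L>)"
      using clique by (simp add: clique_def)
    also have "\<dots> \<le> of_nat (card J)"
      unfolding J_def using X Y L P2 \<delta> by (intro incidence_cov_le) auto
    finally have "ennreal (\<theta> * a * b) \<le> ennreal (card J)"
      using \<theta> by (simp add: a b ennreal_mult ennreal_of_nat_eq_real_of_nat)
    then have J: "\<theta> * a * b \<le> card J" by simp
    define \<tau> where "\<tau> = \<theta> / A"
    have \<tau>: "\<tau> > 0" "\<theta> = \<tau> * A" using A \<theta> by (auto simp: \<tau>_def)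
    have many: "\<tau> * card X * card Y \<le> card J"
    proof -
      have "real (card X) * real (card Y) \<le> real (NP * a) * real (NL * b)"
        using Xa Yb by (intro mult_mono) (auto simp only: of_nat_le_iff of_nat_0_le_iff)
      then have "\<tau> * (real (card X) * real (card Y)) \<le> \<tau> * (real (NP * a) * real (NL * b))"
        using \<tau> by (intro mult_left_mono) auto
      also have "\<dots> = \<theta> * a * b" by (simp add: \<tau>(2) A_def)
      finally show ?thesis using J by simp
    qed
    \<comment> \<open>At scale \<open>n + 1\<close> the radius is \<open>2\<close>, which exceeds
      the diameter of the unit square.\<close>
    have pow: "2^(n + 1) * \<delta> = 2" by (simp add: \<delta>n power_divide)
    have diam: "dist x y < 2^(n + 1) * \<delta>" if "x \<in> X" "y \<in> X" for x y
      unfolding pow using that X(2) sq by (intro dist_unit_square) auto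
    have K: "1 \<le> n + 1" by simp
    obtain k x x' Z Q l where k: "k \<le> n + 1" and x: "x \<in> X" "x' \<in> X" and Z: "Z \<subseteq> Y"
      and Q: "Q \<subseteq> X" and l: "l \<in> Z"
      and cZ: "\<tau>^3 * card Y \<le> 32 * (n + 1) * (n + 1 + 1) * card Z" and cQ: "\<tau> * card X \<le> 4 * card Q"
      and nearZ: "\<forall>l'\<in>Z. x \<in> nbhd l' (3 * \<delta>) \<and> x' \<in> nbhd l' (3 * \<delta>)"
      and far: "k = 0 \<or> 2^k * \<delta> \<le> 2 * dist x x'"
      and nearQ: "\<forall>y\<in>Q. y \<in> nbhd l (3 * \<delta>) \<and> dist x y < 2 * (2^k * \<delta>)"
      by (rule rich_pair[OF X(1) XY(1) Y(1) XY(2) \<tau>(1) many[unfolded J_def] \<delta> K diam])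

    \<comment> \<open>The rectangle spanned by the rich pair\<close>
    define m :: real where "m = 2^k"
    define \<rho> where "\<rho> = dist x x'"
    \<comment> \<open>The half length \<open>50 * \<Delta>\<close> is then at least
      \<open>2 * (m * \<delta>)\<close>, the bound for the distance from \<open>x\<close> to the
      points of \<open>Q\<close>; the maximum ensures
      \<open>\<delta> \<le> \<Delta>\<close>.\<close>
    define \<Delta> where "\<Delta> = max \<delta> (m * \<delta> / 25)"
    have m: "m > 0" by (simp add: m_def)
    \<comment> \<open>The two points coincide only if \<open>k = 0\<close>; then
      \<open>m = 1\<close>, and any unit vector can serve as \<open>f\<close>.\<close>
    have "\<exists>f::real^2. norm f = 1 \<and> (m < 25 \<or> (m * \<delta> \<le> 2 * \<rho> \<and> x' = x + \<rho> *\<^sub>R f))"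
    proof (cases "x' = x")
      case True
      have "0 < 2^k * \<delta>" using \<delta> by simp
      then have "k = 0" using far True by auto
      moreover obtain f :: "real^2" where "norm f = 1" using vector_choose_size[of 1] by auto
      ultimately show ?thesis by (auto simp: m_def)
    next
      case False
      then have "norm ((x' - x) /\<^sub>R \<rho>) = 1" "x' = x + \<rho> *\<^sub>R ((x' - x) /\<^sub>R \<rho>)"
        by (auto simp: \<rho>_def dist_norm norm_minus_commute)
      moreover have "m < 25 \<or> m * \<delta> \<le> 2 * \<rho>" using far by (auto simp: m_def \<rho>_def)
      ultimately show ?thesis by blast
    qed
    then obtain f :: "real^2" where f: "norm f = 1" "m < 25 \<or> (m * \<delta> \<le> 2 * \<rho> \<and> x' = x + \<rho> *\<^sub>R f)"
      by blast
    obtain e where "norm e = 1" "f \<bullet> e = 0" by (rule ex_unit_orthogonal)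
    then have ef: "norm e = 1" "norm f = 1" "e \<bullet> f = 0" using f by (auto simp: inner_commute)
    define R where "R = tube x e f (50 * \<delta>) (50 * \<Delta>)"
    have ZR: "R \<subseteq> nbhd l' (100 * \<delta>)" if "l' \<in> Z" for l'
    proof -
      have "l' \<in> affine_lines" using that Z Y L by auto
      then obtain g c where g: "norm g = 1" "l' = line_of g c" by (rule affine_line_normal)
      have "\<bar>g \<bullet> x - c\<bar> \<le> 3 * \<delta>" "\<bar>g \<bullet> x' - c\<bar> \<le> 3 * \<delta>"
        using nearZ[rule_format, OF that] g by (auto simp: nbhd_line_of)
      then show ?thesis
        using f unfolding R_def g(2) by (intro tube_subset_nbhd[OF ef g(1) \<delta> m _ _ \<Delta>_def]) auto
    qed
    have QR: "y \<in> R" if "y \<in> Q" for y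
    proof -
      have "l \<in> affine_lines" using l Z Y L by auto
      then obtain g c where g: "norm g = 1" "l = line_of g c" by (rule affine_line_normal)
      have "\<bar>g \<bullet> x - c\<bar> \<le> 3 * \<delta>" "\<bar>g \<bullet> x' - c\<bar> \<le> 3 * \<delta>" "\<bar>g \<bullet> y - c\<bar> \<le> 3 * \<delta>"
        "dist x y \<le> 2 * (m * \<delta>)"
        using nearZ[rule_format, OF l] nearQ[rule_format, OF that] g by (auto simp: nbhd_line_of m_def)
      then show ?thesis
        using f unfolding R_def by (intro point_in_tube[OF ef g(1) \<delta> m _ _ \<Delta>_def]) auto
    qed
    have "m * \<delta> \<le> 2^(n + 1) * \<delta>" using k \<delta> unfolding m_def by (intro mult_right_mono power_increasing) auto
    then have "m * \<delta> \<le> 2" by (simp only: pow)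
    moreover have "\<delta> \<le> 1" by (simp add: \<delta>n power_le_one)
    ultimately have \<Delta>: "\<delta> \<le> \<Delta>" "\<Delta> \<le> 2" by (auto simp: \<Delta>_def)

    \<comment> \<open>Counting points and lines of the rectangle\<close>
    have finR: "point_cov \<delta> (P \<inter> R) < \<infinity>" "line_cov \<delta> {l \<in> \<L>. R \<subseteq> nbhd l (100 * \<delta>)} < \<infinity>"
      using fin by (auto intro: le_less_trans[OF covering_number_mono])
    obtain q where q: "point_cov \<delta> (P \<inter> R) = of_nat q" using finR(1) by (rule covering_number_attained)
    obtain z where z: "line_cov \<delta> {l \<in> \<L>. R \<subseteq> nbhd l (100 * \<delta>)} = of_nat z"
      using finR(2) by (rule covering_number_attained)
    \<comment> \<open>A separated subset bounds the covering number from below up to a constant;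
      this is applied to \<open>Q\<close> here and to \<open>Z\<close> next.\<close>
    have "separated dist \<delta> Q" "Q \<subseteq> P \<inter> R" using X Q QR by (auto intro: separated_subset)
    then have "of_nat (card Q) \<le> (of_nat (NP * q) :: ennreal)"
      using NP(2)[OF \<delta> _ _ finR(1)] by (simp add: q)
    then have Qq: "real (card Q) \<le> NP * q" by (simp only: of_nat_le_iff of_nat_mult[symmetric])
    have "separated line_dist \<delta> Z" "Z \<subseteq> {l \<in> \<L>. R \<subseteq> nbhd l (100 * \<delta>)}"
      using Y(2) Z ZR separated_subset[OF Y(3) Z] by blast+
    moreover have "{l \<in> \<L>. R \<subseteq> nbhd l (100 * \<delta>)} \<subseteq> affine_lines" using L by auto
    ultimately have "of_nat (card Z) \<le> (of_nat (NL * z) :: ennreal)"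
      using NL(2)[OF \<delta> _ _ _ finR(2)] by (simp add: z)
    then have Zz: "real (card Z) \<le> NL * z" by (simp only: of_nat_le_iff of_nat_mult[symmetric])
    have log: "log 2 (1/\<delta>) = n" by (simp add: \<delta>n power_divide log_nat_power)
    have "\<theta>\<^sup>2 * a \<le> C1 * q"
    proof -
      \<comment> \<open>The count is linear in \<open>\<theta>\<close>, and
        \<open>\<theta> \<le> 1\<close> passes to the square; for the lines the cube is relaxed to
        the fourth power in the same way.\<close>
      have "\<theta>\<^sup>2 * a \<le> \<theta> * a" using \<theta> by (intro mult_right_mono) (auto simp: power2_eq_square mult_left_le)
      also have "\<dots> \<le> A * (\<tau> * card X)" using aX A \<tau> by (simp add: mult.commute)
      also have "\<dots> \<le> A * (4 * (NP * q))" using cQ Qq A by (intro mult_left_mono) auto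
      also have "\<dots> = 4 * NP * A * q" by simp
      also have "\<dots> \<le> C1 * q" using C1 by (intro mult_right_mono) auto
      finally show ?thesis .
    qed
    then have "inverse C1 * \<theta>\<^sup>2 * a \<le> q" using C1(1) by (simp add: field_simps)
    then have 1: "ennreal (inverse C1 * \<theta>\<^sup>2) * point_cov \<delta> P \<le> point_cov \<delta> (P \<inter> R)"
      using C1(1) unfolding a q ennreal_of_nat_eq_real_of_nat
      by (subst ennreal_mult[symmetric]) auto
    have "\<theta>^4 * b \<le> C1 * n powr C1 * z"
    proof -
      have "\<theta>^4 * b \<le> \<theta>^3 * b" using \<theta> by (intro mult_right_mono power_decreasing) auto
      also have "\<dots> \<le> A^3 * (\<tau>^3 * card Y)"
        using bY A \<tau>(1) by (simp add: \<tau>(2) power_mult_distrib mult_left_mono mult.commute)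
      also have "\<dots> \<le> A^3 * (32 * real (n + 1) * real (n + 1 + 1) * (NL * z))"
      proof (rule mult_left_mono)
        have "32 * real (n + 1) * real (n + 1 + 1) * card Z \<le> 32 * real (n + 1) * real (n + 1 + 1) * (NL * z)"
          using Zz by (intro mult_left_mono) auto
        then show "\<tau>^3 * card Y \<le> 32 * real (n + 1) * real (n + 1 + 1) * (NL * z)"
          by (rule order_trans[OF cZ[unfolded of_nat_mult of_nat_numeral]])
      qed (use A in simp)
      also have "\<dots> \<le> A^3 * (32 * (2 * real n) * (3 * real n) * (NL * z))"
        using n A by (intro mult_left_mono mult_right_mono mult_mono) auto
      also have "\<dots> = 192 * A^3 * NL * (real n)\<^sup>2 * z" by (simp add: power2_eq_square)
      also have "\<dots> \<le> C1 * n powr C1 * z"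
      proof (intro mult_right_mono mult_mono)
        \<comment> \<open>\<open>C1 \<ge> 2\<close> lets the power of the logarithm absorb the two
          factors lost to the number of scales.\<close>
        have "real n powr 2 \<le> real n powr C1" using n C1(1) by (intro powr_mono) auto
        then show "(real n)\<^sup>2 \<le> real n powr C1" using n by simp
      qed (use C1 in auto)
      finally show ?thesis .
    qed
    then have "inverse C1 * log 2 (1/\<delta>) powr (- C1) * \<theta>^4 * b \<le> z"
      using C1(1) n by (simp add: log powr_minus field_simps)
    then have 2: "ennreal (inverse C1 * log 2 (1/\<delta>) powr (- C1) * \<theta>^4) * line_cov \<delta> \<L>
        \<le> line_cov \<delta> {l \<in> \<L>. R \<subseteq> nbhd l (100 * \<delta>)}"
      using C1(1) \<theta> unfolding b z ennreal_of_nat_eq_real_of_nat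
      by (subst ennreal_mult[symmetric]) auto
    have "norm x \<le> 2" using x X P2 by fastforce
    with ef \<Delta> 1 2 show "\<exists>\<Delta> x e f. norm e = 1 \<and> norm f = 1 \<and> e \<bullet> f = 0 \<and> norm x \<le> 2 \<and> \<delta> \<le> \<Delta> \<and> \<Delta> \<le> 2 \<and>
        ennreal (inverse C1 * \<theta>^2) * point_cov \<delta> P
          \<le> point_cov \<delta> (P \<inter> tube x e f (50 * \<delta>) (50 * \<Delta>)) \<and>
        ennreal (inverse C1 * log 2 (1/\<delta>) powr (- C1) * \<theta>^4) * line_cov \<delta> \<L>
          \<le> line_cov \<delta> {l \<in> \<L>. tube x e f (50 * \<delta>) (50 * \<Delta>) \<subseteq> nbhd l (100 * \<delta>)}"
      unfolding R_def by blast
  qed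
qed

section \<open>Katz--Tao sets\<close>

text \<open>The tube lies in a ball of radius comparable to \<open>\<Delta>\<close>, hence in
  boundedly many balls of a radius that the Katz-Tao condition admits.\<close>

lemma katz_tao_points_tube:
  obtains N :: nat where "\<forall>\<delta> \<Delta> s K P x e f. 0 < \<delta> \<longrightarrow> \<delta> \<le> 1 \<longrightarrow> \<delta> \<le> \<Delta> \<longrightarrow> \<Delta> \<le> 2 \<longrightarrow> 0 < s \<longrightarrow> K \<ge> 1 \<longrightarrow>
    norm e = 1 \<longrightarrow> norm f = 1 \<longrightarrow> katz_tao_points \<delta> s K P \<longrightarrow>
    point_cov \<delta> (P \<inter> tube x e f (50 * \<delta>) (50 * \<Delta>)) \<le> of_nat N * ennreal (K * (\<Delta> / \<delta>) powr s)"
proof -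
  obtain N :: nat where N: "\<And>r x S \<rho> k. r > 0 \<Longrightarrow> S \<subseteq> ball x (201 * r) \<Longrightarrow>
     (\<And>c. point_cov \<rho> (S \<inter> ball c r) \<le> k) \<Longrightarrow> point_cov \<rho> S \<le> of_nat N * k"
    using doubling_space.covering_number_ball_le[OF doubling_space_points, where B = 201]
    by (metis UNIV_I mball_eq_ball)
  show thesis
  proof (rule that, intro allI impI)
    fix \<delta> \<Delta> s K :: real and P and x e f :: "real^2"
    assume \<delta>: "0 < \<delta>" "\<delta> \<le> 1" and \<Delta>: "\<delta> \<le> \<Delta>" "\<Delta> \<le> 2" and s: "0 < s" and K: "K \<ge> 1"
      and ef: "norm e = 1" "norm f = 1" and KT: "katz_tao_points \<delta> s K P"
    \<comment> \<open>\<open>\<Delta>\<close> may reach \<open>2\<close>, whereas the condition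
      stops at radius \<open>1\<close>. Since \<open>\<Delta> \<le> 2 * r\<close>, the tube stays
      within \<open>50 * r + 100 * r\<close> of \<open>x\<close>.\<close>
    define r where "r = min \<Delta> 1"
    have r: "\<delta> \<le> r" "r \<le> 1" "r \<le> \<Delta>" "\<Delta> \<le> 2 * r" using \<delta> \<Delta> by (auto simp: r_def)
    show "point_cov \<delta> (P \<inter> tube x e f (50 * \<delta>) (50 * \<Delta>)) \<le> of_nat N * ennreal (K * (\<Delta> / \<delta>) powr s)"
    proof (rule N)
      show "r > 0" using \<delta> r by simp
      show "P \<inter> tube x e f (50 * \<delta>) (50 * \<Delta>) \<subseteq> ball x (201 * r)"
      proof
        fix y assume "y \<in> P \<inter> tube x e f (50 * \<delta>) (50 * \<Delta>)"
        then obtain u v where y: "y = x + u *\<^sub>R e + v *\<^sub>R f" and uv: "\<bar>u\<bar> \<le> 50 * \<delta>" "\<bar>v\<bar> \<le> 50 * \<Delta>"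
          by (auto simp: tube_def)
        have "dist x y = norm (u *\<^sub>R e + v *\<^sub>R f)"
          unfolding y dist_commute[of x] by (simp add: dist_norm add.assoc)
        also have "\<dots> \<le> \<bar>u\<bar> + \<bar>v\<bar>"
          using norm_triangle_ineq[of "u *\<^sub>R e" "v *\<^sub>R f"] ef by simp
        finally show "y \<in> ball x (201 * r)" using uv r \<delta> \<Delta> by simp
      qed
      fix c
      have "point_cov \<delta> (P \<inter> tube x e f (50 * \<delta>) (50 * \<Delta>) \<inter> ball c r) \<le> point_cov \<delta> (P \<inter> ball c r)"
        by (intro covering_number_mono) auto
      also have "\<dots> \<le> ennreal (K * (r / \<delta>) powr s)"
        using KT r by (simp add: katz_tao_points_def)
      also have "\<dots> \<le> ennreal (K * (\<Delta> / \<delta>) powr s)"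
        using r \<delta> K s by (intro ennreal_leI mult_left_mono powr_mono2 divide_right_mono) auto
      finally show "point_cov \<delta> (P \<inter> tube x e f (50 * \<delta>) (50 * \<Delta>) \<inter> ball c r) \<le> \<dots>" .
    qed
  qed
qed

text \<open>By \<open>line_dist_tube_le\<close> these lines lie in a ball of radius
  \<open>O(\<delta> / \<Delta>)\<close>, so \<open>\<Delta>\<close> enters with an exponent of the
  opposite sign to that for the points.\<close>

lemma katz_tao_lines_tube:
  obtains N :: nat where "\<forall>\<delta> \<Delta> t K \<L> x e f. 0 < \<delta> \<longrightarrow> \<delta> \<le> 1 \<longrightarrow> \<delta> \<le> \<Delta> \<longrightarrow> \<Delta> \<le> 2 \<longrightarrow> 0 < t \<longrightarrow> t \<le> 1 \<longrightarrow> K \<ge> 1 \<longrightarrow>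
    norm e = 1 \<longrightarrow> norm f = 1 \<longrightarrow> e \<bullet> f = 0 \<longrightarrow> norm x \<le> 2 \<longrightarrow> katz_tao_lines \<delta> t K \<L> \<longrightarrow>
    line_cov \<delta> {l \<in> \<L>. tube x e f (50 * \<delta>) (50 * \<Delta>) \<subseteq> nbhd l (100 * \<delta>)}
      \<le> of_nat N * ennreal (2 * K * (1 / \<Delta>) powr t)"
proof -
  obtain N :: nat where N: "\<And>r x S \<rho> k. r > 0 \<Longrightarrow> x \<in> affine_lines \<Longrightarrow> S \<subseteq> Lines.mball x (1000 * r) \<Longrightarrow>
     (\<And>c. c \<in> affine_lines \<Longrightarrow> line_cov \<rho> (S \<inter> Lines.mball c r) \<le> k) \<Longrightarrow> line_cov \<rho> S \<le> of_nat N * k"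
    using doubling_space.covering_number_ball_le[OF doubling_space_lines, where B = 1000] by metis
  show thesis
  proof (rule that, intro allI impI)
    fix \<delta> \<Delta> t K :: real and \<L> and x e f :: "real^2"
    assume \<delta>: "0 < \<delta>" "\<delta> \<le> 1" and \<Delta>: "\<delta> \<le> \<Delta>" "\<Delta> \<le> 2" and t: "0 < t" "t \<le> 1" and K: "K \<ge> 1"
      and ef: "norm e = 1" "norm f = 1" "e \<bullet> f = 0" and x: "norm x \<le> 2" and KT: "katz_tao_lines \<delta> t K \<L>"
    define S where "S = {l \<in> \<L>. tube x e f (50 * \<delta>) (50 * \<Delta>) \<subseteq> nbhd l (100 * \<delta>)}"
    have L: "\<L> \<subseteq> affine_lines" using KT by (simp add: katz_tao_lines_def)
    \<comment> \<open>For \<open>\<Delta> > 1\<close> the radius \<open>\<delta> / \<Delta>\<close>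
      falls below the smallest admissible one. As \<open>\<Delta> \<le> 2\<close>, the ratio
      \<open>r / \<delta>\<close> is still at most \<open>2 / \<Delta>\<close>, and
      \<open>2 powr t \<le> 2\<close> accounts for the factor \<open>2\<close>.\<close>
    define r where "r = max \<delta> (\<delta> / \<Delta>)"
    have r: "\<delta> \<le> r" "r \<le> 1" "\<delta> / \<Delta> \<le> r" "r / \<delta> \<le> 2 / \<Delta>"
      using \<delta> \<Delta> by (auto simp: r_def field_simps max_def)
    show "line_cov \<delta> S \<le> of_nat N * ennreal (2 * K * (1 / \<Delta>) powr t)"
    proof (cases "S = {}")
      case True
      then show ?thesis by (simp add: covering_number_empty)
    next
      case False
      then obtain l0 where l0: "l0 \<in> S" by blast
      show ?thesis
      proof (rule N)
        show "r > 0" using \<delta> r by simp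
        show "l0 \<in> affine_lines" using l0 L by (auto simp: S_def)
        show "S \<subseteq> Lines.mball l0 (1000 * r)"
        proof
          fix l assume l: "l \<in> S"
          have "line_dist l0 l < 1000 * (\<delta> / \<Delta>)"
            using l l0 L \<delta> \<Delta> x by (intro line_dist_tube_le[OF ef]) (auto simp: S_def)
          also have "\<dots> \<le> 1000 * r" using r by simp
          finally show "l \<in> Lines.mball l0 (1000 * r)" using l l0 L by (auto simp: S_def)
        qed
        fix c assume c: "c \<in> affine_lines"
        have "line_cov \<delta> (S \<inter> Lines.mball c r) \<le> line_cov \<delta> (\<L> \<inter> Lines.mball c r)"
          by (intro covering_number_mono) (auto simp: S_def)
        also have "\<dots> \<le> ennreal (K * (r / \<delta>) powr t)"
          using KT r c by (simp add: katz_tao_lines_def)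
        also have "\<dots> \<le> ennreal (2 * K * (1 / \<Delta>) powr t)"
        proof (rule ennreal_leI)
          have "(r / \<delta>) powr t \<le> (2 * (1 / \<Delta>)) powr t"
            using r \<delta> t by (intro powr_mono2) auto
          also have "\<dots> = 2 powr t * (1 / \<Delta>) powr t" by (rule powr_mult)
          also have "\<dots> \<le> 2 * (1 / \<Delta>) powr t"
            using t powr_mono[of t 1 "2::real"] by (intro mult_right_mono; simp)
          finally show "K * (r / \<delta>) powr t \<le> 2 * K * (1 / \<Delta>) powr t"
            using K by (simp add: mult.commute mult.left_commute)
        qed
        finally show "line_cov \<delta> (S \<inter> Lines.mball c r) \<le> ennreal (2 * K * (1 / \<Delta>) powr t)" .
      qed
    qed
  qed
qed

text \<open>From \<open>b \<ge> 1\<close> and \<open>t \<le> 1\<close> follows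
  \<open>b powr t \<le> b\<close>; this keeps the final constant independent of the
  exponents.\<close>

lemma powr_le_of_le:
  fixes a b y s t :: real
  assumes "0 \<le> a" "a \<le> b * y powr s" "b \<ge> 1" "y \<ge> 0" "0 < t" "t \<le> 1"
  shows "a powr t \<le> b * y powr (s * t)"
proof -
  have "a powr t \<le> (b * y powr s) powr t" using assms by (intro powr_mono2) auto
  also have "\<dots> = b powr t * y powr (s * t)" using assms by (simp add: powr_mult powr_powr)
  also have "\<dots> \<le> b * y powr (s * t)"
    using assms powr_mono[of t 1 b] by (intro mult_right_mono) auto
  finally show ?thesis .
qed

lemma ennreal_powr_of_nat: "ennreal_powr (of_nat a) t = ennreal (real a powr t)"
  by (simp add: ennreal_powr_def)

theorem proposition1p16:
  shows
    "(\<exists>C\<ge>1. \<exists>C1\<ge>1. \<forall>(\<delta>::real) (\<theta>::real) (P::(real^2) set) (\<L>::(real^2) set set).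
        \<delta> \<in> range (\<lambda>n::nat. (1/2) ^ n) \<and> \<delta> \<le> 1/2 \<and> 0 < \<theta> \<and> \<theta> \<le> 1 \<and>
        P \<noteq> {} \<and> P \<subseteq> {x. \<forall>i. 0 \<le> x $ i \<and> x $ i < 1} \<and>
        \<L> \<noteq> {} \<and> \<L> \<subseteq> affine_lines \<and> clique \<delta> \<theta> P \<L> \<longrightarrow>
        (\<exists>\<Delta> R. \<delta> \<le> \<Delta> \<and> \<Delta> \<le> 2 \<and> is_rectangle (C * \<delta>) (C * \<Delta>) R \<and>
           point_cov \<delta> (P \<inter> R) \<ge> ennreal (inverse C1 * \<theta>^2) * point_cov \<delta> P \<and>
           line_cov \<delta> {l\<in>\<L>. R \<subseteq> nbhd l (C * \<delta>)}
             \<ge> ennreal (inverse C1 * log 2 (1/\<delta>) powr (- C1) * \<theta>^4) * line_cov \<delta> \<L>)) \<and>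
     (\<forall>(K\<^sub>P::real) (K\<^sub>L::real). K\<^sub>P \<ge> 1 \<and> K\<^sub>L \<ge> 1 \<longrightarrow>
       (\<exists>C2\<ge>1. \<forall>(s::real) (t::real) (\<delta>::real) (\<theta>::real) (P::(real^2) set) (\<L>::(real^2) set set).
          0 < s \<and> s \<le> 1 \<and> 0 < t \<and> t \<le> 1 \<and>
          \<delta> \<in> range (\<lambda>n::nat. (1/2) ^ n) \<and> \<delta> \<le> 1/2 \<and> 0 < \<theta> \<and> \<theta> \<le> 1 \<and>
          P \<noteq> {} \<and> P \<subseteq> {x. \<forall>i. 0 \<le> x $ i \<and> x $ i < 1} \<and>
          \<L> \<noteq> {} \<and> \<L> \<subseteq> affine_lines \<and> clique \<delta> \<theta> P \<L> \<and>
          katz_tao_points \<delta> s K\<^sub>P P \<and> katz_tao_lines \<delta> t K\<^sub>L \<L> \<longrightarrow>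
          ennreal_powr (point_cov \<delta> P) t * ennreal_powr (line_cov \<delta> \<L>) s
            \<le> ennreal (C2 * log 2 (1/\<delta>) powr C2 * \<theta> powr (-6) * \<delta> powr (- (s * t)))))"
proof (intro conjI allI impI)
  obtain C1 :: real where C1: "C1 \<ge> 2"
    and tube: "\<forall>n \<delta> \<theta> P \<L>. \<delta> = (1/2)^n \<longrightarrow> n \<ge> 1 \<longrightarrow> 0 < \<theta> \<longrightarrow> \<theta> \<le> 1 \<longrightarrow> P \<noteq> {} \<longrightarrow>
      P \<subseteq> {x. \<forall>i. 0 \<le> x $ i \<and> x $ i < 1} \<longrightarrow> \<L> \<noteq> {} \<longrightarrow> clique \<delta> \<theta> P \<L> \<longrightarrow>
      (\<exists>\<Delta> x e f. norm e = 1 \<and> norm f = 1 \<and> e \<bullet> f = 0 \<and> norm x \<le> 2 \<and> \<delta> \<le> \<Delta> \<and> \<Delta> \<le> 2 \<and>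
        ennreal (inverse C1 * \<theta>^2) * point_cov \<delta> P
          \<le> point_cov \<delta> (P \<inter> tube x e f (50 * \<delta>) (50 * \<Delta>)) \<and>
        ennreal (inverse C1 * log 2 (1/\<delta>) powr (- C1) * \<theta>^4) * line_cov \<delta> \<L>
          \<le> line_cov \<delta> {l \<in> \<L>. tube x e f (50 * \<delta>) (50 * \<Delta>) \<subseteq> nbhd l (100 * \<delta>)})"
    by (rule clique_tube)
  \<comment> \<open>The bound \<open>\<delta> \<le> 1/2\<close> excludes \<open>n = 0\<close>, so
    that the logarithm is at least \<open>1\<close>.\<close>
  have exponent: "\<exists>n\<ge>1. \<delta> = (1/2)^n" if \<delta>: "\<delta> \<in> range (\<lambda>n::nat. (1/2) ^ n)" "\<delta> \<le> 1/2" for \<delta> :: real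
  proof -
    obtain n :: nat where n: "\<delta> = (1/2)^n" using \<delta>(1) by (rule imageE)
    moreover have "n \<ge> 1" using \<delta>(2) n by (cases n) auto
    ultimately show ?thesis by blast
  qed

  \<comment> \<open>Existence of the rectangle\<close>
  show "\<exists>C\<ge>1. \<exists>C1\<ge>1. \<forall>(\<delta>::real) (\<theta>::real) (P::(real^2) set) (\<L>::(real^2) set set).
        \<delta> \<in> range (\<lambda>n::nat. (1/2) ^ n) \<and> \<delta> \<le> 1/2 \<and> 0 < \<theta> \<and> \<theta> \<le> 1 \<and>
        P \<noteq> {} \<and> P \<subseteq> {x. \<forall>i. 0 \<le> x $ i \<and> x $ i < 1} \<and>
        \<L> \<noteq> {} \<and> \<L> \<subseteq> affine_lines \<and> clique \<delta> \<theta> P \<L> \<longrightarrow>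
        (\<exists>\<Delta> R. \<delta> \<le> \<Delta> \<and> \<Delta> \<le> 2 \<and> is_rectangle (C * \<delta>) (C * \<Delta>) R \<and>
           point_cov \<delta> (P \<inter> R) \<ge> ennreal (inverse C1 * \<theta>^2) * point_cov \<delta> P \<and>
           line_cov \<delta> {l\<in>\<L>. R \<subseteq> nbhd l (C * \<delta>)}
             \<ge> ennreal (inverse C1 * log 2 (1/\<delta>) powr (- C1) * \<theta>^4) * line_cov \<delta> \<L>)"
  \<comment> \<open>\<open>100\<close> is twice the half side length \<open>50\<close> and also the
    constant of the neighbourhoods.\<close>
  proof (rule exI[of _ 100], rule conjI, simp, rule exI[of _ C1], rule conjI, use C1 in simp, intro allI impI, elim conjE)
    fix \<delta> \<theta> :: real and P :: "(real^2) set" and \<L> :: "(real^2) set set"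
    assume "\<delta> \<in> range (\<lambda>n::nat. (1/2) ^ n)" "\<delta> \<le> 1/2"
      and hyps: "0 < \<theta>" "\<theta> \<le> 1" "P \<noteq> {}" "P \<subseteq> {x. \<forall>i. 0 \<le> x $ i \<and> x $ i < 1}" "\<L> \<noteq> {}" "clique \<delta> \<theta> P \<L>"
    then obtain n where n: "n \<ge> 1" "\<delta> = (1/2)^n" using exponent by blast
    from tube[rule_format, OF n(2,1) hyps] obtain \<Delta> x e f where *: "norm e = 1" "norm f = 1" "e \<bullet> f = 0"
      "\<delta> \<le> \<Delta>" "\<Delta> \<le> 2"
      "ennreal (inverse C1 * \<theta>^2) * point_cov \<delta> P
          \<le> point_cov \<delta> (P \<inter> tube x e f (50 * \<delta>) (50 * \<Delta>))"
      "ennreal (inverse C1 * log 2 (1/\<delta>) powr (- C1) * \<theta>^4) * line_cov \<delta> \<L>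
          \<le> line_cov \<delta> {l \<in> \<L>. tube x e f (50 * \<delta>) (50 * \<Delta>) \<subseteq> nbhd l (100 * \<delta>)}"
      by blast
    moreover have "is_rectangle (100 * \<delta>) (100 * \<Delta>) (tube x e f (50 * \<delta>) (50 * \<Delta>))"
      using is_rectangle_tube[OF *(1-3), of "50 * \<delta>" "50 * \<Delta>" x] by simp
    ultimately show "\<exists>\<Delta> R. \<delta> \<le> \<Delta> \<and> \<Delta> \<le> 2 \<and> is_rectangle (100 * \<delta>) (100 * \<Delta>) R \<and>
           point_cov \<delta> (P \<inter> R) \<ge> ennreal (inverse C1 * \<theta>^2) * point_cov \<delta> P \<and>
           line_cov \<delta> {l\<in>\<L>. R \<subseteq> nbhd l (100 * \<delta>)}
             \<ge> ennreal (inverse C1 * log 2 (1/\<delta>) powr (- C1) * \<theta>^4) * line_cov \<delta> \<L>"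
      by blast
  qed

  \<comment> \<open>The Katz-Tao bound\<close>
  fix K\<^sub>P K\<^sub>L :: real
  assume "K\<^sub>P \<ge> 1 \<and> K\<^sub>L \<ge> 1"
  then have K: "K\<^sub>P \<ge> 1" "K\<^sub>L \<ge> 1" by auto
  obtain N1 :: nat where N1: "\<forall>\<delta> \<Delta> s K P x e f. 0 < \<delta> \<longrightarrow> \<delta> \<le> 1 \<longrightarrow> \<delta> \<le> \<Delta> \<longrightarrow> \<Delta> \<le> 2 \<longrightarrow> 0 < s \<longrightarrow> K \<ge> 1 \<longrightarrow>
    norm e = 1 \<longrightarrow> norm f = 1 \<longrightarrow> katz_tao_points \<delta> s K P \<longrightarrow>
    point_cov \<delta> (P \<inter> tube x e f (50 * \<delta>) (50 * \<Delta>)) \<le> of_nat N1 * ennreal (K * (\<Delta> / \<delta>) powr s)"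
    by (rule katz_tao_points_tube)
  obtain N2 :: nat where N2: "\<forall>\<delta> \<Delta> t K \<L> x e f. 0 < \<delta> \<longrightarrow> \<delta> \<le> 1 \<longrightarrow> \<delta> \<le> \<Delta> \<longrightarrow> \<Delta> \<le> 2 \<longrightarrow> 0 < t \<longrightarrow> t \<le> 1 \<longrightarrow> K \<ge> 1 \<longrightarrow>
    norm e = 1 \<longrightarrow> norm f = 1 \<longrightarrow> e \<bullet> f = 0 \<longrightarrow> norm x \<le> 2 \<longrightarrow> katz_tao_lines \<delta> t K \<L> \<longrightarrow>
    line_cov \<delta> {l \<in> \<L>. tube x e f (50 * \<delta>) (50 * \<Delta>) \<subseteq> nbhd l (100 * \<delta>)}
      \<le> of_nat N2 * ennreal (2 * K * (1 / \<Delta>) powr t)"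
    by (rule katz_tao_lines_tube)
  \<comment> \<open>The summand \<open>1\<close> keeps both constants at least \<open>1\<close> even
    if \<open>N1\<close> or \<open>N2\<close> is zero; \<open>powr_le_of_le\<close> asks for
    this.\<close>
  define B1 where "B1 = C1 * ((N1 + 1) * K\<^sub>P)"
  define B2 where "B2 = C1 * ((N2 + 1) * (2 * K\<^sub>L))"
  have "1 * (1 * 1) \<le> B1" "1 * (1 * 1) \<le> B2"
    unfolding B1_def B2_def using C1 K by (intro mult_mono; simp)+
  then have B: "B1 \<ge> 1" "B2 \<ge> 1" by simp_all
  \<comment> \<open>\<open>C2\<close> has to serve both as factor and as exponent of the logarithm;
    neither \<open>s\<close> nor \<open>t\<close> enters it.\<close>
  define C2 where "C2 = B1 * B2 * C1"
  have "1 * 1 \<le> B1 * B2" using B by (intro mult_mono) auto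
  then have "B1 * B2 * 1 \<le> C2" "1 * C1 \<le> C2" unfolding C2_def using C1
    by (intro mult_left_mono mult_right_mono; simp)+
  then have C2: "B1 * B2 \<le> C2" "C1 \<le> C2" by simp_all
  show "\<exists>C2\<ge>1. \<forall>(s::real) (t::real) (\<delta>::real) (\<theta>::real) (P::(real^2) set) (\<L>::(real^2) set set).
          0 < s \<and> s \<le> 1 \<and> 0 < t \<and> t \<le> 1 \<and>
          \<delta> \<in> range (\<lambda>n::nat. (1/2) ^ n) \<and> \<delta> \<le> 1/2 \<and> 0 < \<theta> \<and> \<theta> \<le> 1 \<and>
          P \<noteq> {} \<and> P \<subseteq> {x. \<forall>i. 0 \<le> x $ i \<and> x $ i < 1} \<and>
          \<L> \<noteq> {} \<and> \<L> \<subseteq> affine_lines \<and> clique \<delta> \<theta> P \<L> \<and>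
          katz_tao_points \<delta> s K\<^sub>P P \<and> katz_tao_lines \<delta> t K\<^sub>L \<L> \<longrightarrow>
          ennreal_powr (point_cov \<delta> P) t * ennreal_powr (line_cov \<delta> \<L>) s
            \<le> ennreal (C2 * log 2 (1/\<delta>) powr C2 * \<theta> powr (-6) * \<delta> powr (- (s * t)))"
  proof (rule exI[of _ C2], rule conjI, use C1 C2 in simp, intro allI impI, elim conjE)
    fix s t \<delta> \<theta> :: real and P :: "(real^2) set" and \<L> :: "(real^2) set set"
    assume s: "0 < s" "s \<le> 1" and t: "0 < t" "t \<le> 1"
      and \<delta>': "\<delta> \<in> range (\<lambda>n::nat. (1/2) ^ n)" "\<delta> \<le> 1/2"
      and hyps: "0 < \<theta>" "\<theta> \<le> 1" "P \<noteq> {}" "P \<subseteq> {x. \<forall>i. 0 \<le> x $ i \<and> x $ i < 1}" "\<L> \<noteq> {}" "clique \<delta> \<theta> P \<L>"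
      and KT: "katz_tao_points \<delta> s K\<^sub>P P" "katz_tao_lines \<delta> t K\<^sub>L \<L>"
    obtain n where n: "n \<ge> 1" "\<delta> = (1/2)^n" using \<delta>' exponent by blast
    have \<delta>: "0 < \<delta>" "\<delta> \<le> 1" using n(2) \<delta>'(2) by auto
    have log: "log 2 (1/\<delta>) = n" by (simp add: n(2) power_divide log_nat_power)
    from tube[rule_format, OF n(2,1) hyps] obtain \<Delta> x e f where ef: "norm e = 1" "norm f = 1" "e \<bullet> f = 0"
      and x: "norm x \<le> 2" and \<Delta>: "\<delta> \<le> \<Delta>" "\<Delta> \<le> 2"
      and points: "ennreal (inverse C1 * \<theta>^2) * point_cov \<delta> P
          \<le> point_cov \<delta> (P \<inter> tube x e f (50 * \<delta>) (50 * \<Delta>))"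
      and lines: "ennreal (inverse C1 * log 2 (1/\<delta>) powr (- C1) * \<theta>^4) * line_cov \<delta> \<L>
          \<le> line_cov \<delta> {l \<in> \<L>. tube x e f (50 * \<delta>) (50 * \<Delta>) \<subseteq> nbhd l (100 * \<delta>)}"
      by blast
    have "P \<subseteq> ball 0 2" using norm_unit_square hyps(4) by fastforce
    \<comment> \<open>Both covering numbers are finite, so \<open>ennreal_powr\<close> is an
      ordinary real power here.\<close>
    from clique_cov_finite[OF \<delta>(1) hyps(3) this hyps(1,6)]
    obtain a b :: nat where a: "point_cov \<delta> P = of_nat a" and b: "line_cov \<delta> \<L> = of_nat b"
      by (metis covering_number_attained)
    have "ennreal (inverse C1 * \<theta>\<^sup>2 * a) = ennreal (inverse C1 * \<theta>\<^sup>2) * point_cov \<delta> P"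
      using C1 by (simp add: a ennreal_of_nat_eq_real_of_nat ennreal_mult)
    also note points
    also note N1[rule_format, OF \<delta> \<Delta> s(1) K(1) ef(1,2) KT(1)]
    also have "of_nat N1 * ennreal (K\<^sub>P * (\<Delta> / \<delta>) powr s) = ennreal (N1 * (K\<^sub>P * (\<Delta> / \<delta>) powr s))"
      using K by (simp add: ennreal_of_nat_eq_real_of_nat ennreal_mult)
    finally have "inverse C1 * \<theta>\<^sup>2 * a \<le> N1 * (K\<^sub>P * (\<Delta> / \<delta>) powr s)"
      using K by (subst (asm) ennreal_le_iff) auto
    also have "\<dots> \<le> (N1 + 1) * (K\<^sub>P * (\<Delta> / \<delta>) powr s)" using K by (intro mult_right_mono) auto
    finally have a_le: "a \<le> B1 / \<theta>\<^sup>2 * (\<Delta> / \<delta>) powr s"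
      using C1 hyps(1) by (simp add: B1_def field_simps)
    have "ennreal (inverse C1 * log 2 (1/\<delta>) powr (- C1) * \<theta>^4 * b)
        = ennreal (inverse C1 * log 2 (1/\<delta>) powr (- C1) * \<theta>^4) * line_cov \<delta> \<L>"
      using C1 by (simp add: b ennreal_of_nat_eq_real_of_nat ennreal_mult)
    also note lines
    also note N2[rule_format, OF \<delta> \<Delta> t K(2) ef x KT(2)]
    also have "of_nat N2 * ennreal (2 * K\<^sub>L * (1 / \<Delta>) powr t) = ennreal (N2 * (2 * K\<^sub>L * (1 / \<Delta>) powr t))"
      using K by (simp add: ennreal_of_nat_eq_real_of_nat ennreal_mult)
    finally have "inverse C1 * log 2 (1/\<delta>) powr (- C1) * \<theta>^4 * b \<le> N2 * (2 * K\<^sub>L * (1 / \<Delta>) powr t)"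
      using K by (subst (asm) ennreal_le_iff) auto
    also have "\<dots> \<le> (N2 + 1) * (2 * K\<^sub>L * (1 / \<Delta>) powr t)" using K by (intro mult_right_mono) auto
    finally have b_le: "b \<le> B2 * n powr C1 / \<theta>^4 * (1 / \<Delta>) powr t"
      using C1 hyps(1) n by (simp add: B2_def log powr_minus field_simps)
    have n1: "real n powr C1 \<ge> 1" using n C1 by (intro ge_one_powr_ge_zero) auto
    have "\<theta>\<^sup>2 * 1 \<le> 1 * B1" "\<theta>^4 * 1 \<le> 1 * (B2 * n powr C1)"
      using hyps(1,2) B n1 mult_mono[of 1 B2 1 "n powr C1"]
      by (intro mult_mono power_le_one; simp)+
    then have ge1: "B1 / \<theta>\<^sup>2 \<ge> 1" "B2 * n powr C1 / \<theta>^4 \<ge> 1"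
      using hyps(1) by (simp_all add: field_simps)
    \<comment> \<open>The bound for the points is raised to \<open>t\<close>, that for the lines to
      \<open>s\<close>, and the constants keep their first power. The powers of
      \<open>\<Delta>\<close> cancel, and \<open>2 + 4\<close> gives the exponent \<open>6\<close>
      of \<open>1 / \<theta>\<close>.\<close>
    have "a powr t * b powr s \<le> (B1 / \<theta>\<^sup>2 * (\<Delta> / \<delta>) powr (s * t)) * (B2 * n powr C1 / \<theta>^4 * (1 / \<Delta>) powr (t * s))"
      using a_le b_le ge1 s t \<delta> \<Delta> B hyps(1) by (intro mult_mono powr_le_of_le) auto
    also have "\<dots> = B1 * B2 * n powr C1 * (1 / \<theta>^6) * ((\<Delta> / \<delta>) powr (s * t) * (1 / \<Delta>) powr (s * t))"
      by (simp add: mult.commute[of t s] field_simps power_add[symmetric])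
    also have "(\<Delta> / \<delta>) powr (s * t) * (1 / \<Delta>) powr (s * t) = (\<Delta> / \<delta> * (1 / \<Delta>)) powr (s * t)"
      by (simp only: powr_mult)
    also have "\<Delta> / \<delta> * (1 / \<Delta>) = 1 / \<delta>" using \<delta> \<Delta> by simp
    also have "(1 / \<delta>) powr (s * t) = \<delta> powr (- (s * t))"
      using \<delta> by (simp add: powr_minus_divide powr_divide)
    also have "1 / \<theta>^6 = \<theta> powr (-6)" using hyps(1) by (simp add: powr_minus_divide)
    also have "B1 * B2 * n powr C1 * \<theta> powr (-6) * \<delta> powr (- (s * t))
        \<le> C2 * n powr C2 * \<theta> powr (-6) * \<delta> powr (- (s * t))"
      using C2 B C1 n by (intro mult_right_mono mult_mono powr_mono) auto
    finally have "ennreal (a powr t * b powr s) \<le> ennreal (C2 * n powr C2 * \<theta> powr (-6) * \<delta> powr (- (s * t)))"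
      by (rule ennreal_leI)
    then show "ennreal_powr (point_cov \<delta> P) t * ennreal_powr (line_cov \<delta> \<L>) s
            \<le> ennreal (C2 * log 2 (1/\<delta>) powr C2 * \<theta> powr (-6) * \<delta> powr (- (s * t)))"
      by (simp add: a b log ennreal_powr_of_nat ennreal_mult)
  qed
qed

end
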